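(* Let $d\ge1$ be an integer, let $1\le q<\infty$, and let $I\subseteq\mathbb{R}$ be a bounded open interval. Let $A_n\to A$ in $W^{1,q}(I,\mathrm{Norm}(d))$ as $n\to\infty$. Let $\lambda,\lambda_n\in W^{1,q}(I,\mathbb{C}^d)$ be parameterizations of the eigenvalues of $A$, $A_n$, respectively. Then $$\big\|\,\|\lambda'\|_2-\|\lambda_n'\|_2\,\big\|_{L^q(I)}\to0\qquad\text{and}\qquad\|\lambda_n'\|_{L^q(I,\mathbb{C}^d)}\to\|\lambda'\|_{L^q(I,\mathbb{C}^d)}$$ as $n\to\infty$.
   Context: $M_d(\mathbb{C})$ is the space of complex $d\times d$ matrices with the Frobenius norm $\|\cdot\|_2$, and $\mathrm{Norm}(d)=\{A\in M_d(\mathbb{C}):A^*A=AA^*\}$. $W^{1,q}(I,\mathrm{Norm}(d))$ is the set of $A\in W^{1,q}(I,M_d(\mathbb{C}))$ with values in $\mathrm{Norm}(d)$, with the topology induced by the norm $\|A\|_{L^q}+\|A'\|_{L^q}$ of $W^{1,q}(I,M_d(\mathbb{C}))$. Here $\|f\|_{L^q}=\big\|\,\|f\|_2\,\big\|_{L^q(I)}$ for vector- or matrix-valued $f$. We use absolutely continuous representatives. A parameterization of the eigenvalues of $A$ is a map $\lambda=(\lambda_1,\dots,\lambda_d):I\to\mathbb{C}^d$ such that for each $x\in I$ the numbers $\lambda_1(x),\dots,\lambda_d(x)$ are the eigenvalues of $A(x)$ counted with multiplicity. *)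

theory Defs
  imports
    "HOL-Analysis.Analysis"
    "HOL-Computational_Algebra.Computational_Algebra"
begin

section \<open>Normal matrices and their eigenvalues\<close>

text \<open>The norm that HOL-Analysis puts on \<open>complex^'d^'d\<close> is the Frobenius norm:\<close>

lemma norm_matrix_Frobenius:
  fixes A :: "complex^'n^'m"
  shows "norm A = sqrt (\<Sum>i\<in>UNIV. \<Sum>j\<in>UNIV. (cmod (A $ i $ j))\<^sup>2)"
  by (simp add: norm_vec_def L2_set_def sum_nonneg)

definition conj_transpose :: "complex^'n^'m \<Rightarrow> complex^'m^'n" where
  "conj_transpose A = (\<chi> i j. cnj (A $ j $ i))"

definition normal_matrices :: "(complex^'d^'d) set" where
  "normal_matrices = {A. conj_transpose A ** A = A ** conj_transpose A}"

definition charpoly :: "complex^'d^'d \<Rightarrow> complex poly" where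
  "charpoly A = det (\<chi> i j. (if i = j then [:0, 1:] else 0) - [:A $ i $ j:])"

text \<open>Eigenvalues with algebraic multiplicity, as a multiset.\<close>

definition eigenvalues :: "complex^'d^'d \<Rightarrow> complex multiset" where
  "eigenvalues A = proots (charpoly A)"

definition eigenvalue_parameterization ::
  "real set \<Rightarrow> (real \<Rightarrow> complex^'d^'d) \<Rightarrow> (real \<Rightarrow> complex^'d) \<Rightarrow> bool" where
  "eigenvalue_parameterization I A l \<longleftrightarrow>
     (\<forall>x\<in>I. image_mset (\<lambda>i. l x $ i) (mset_set UNIV) = eigenvalues (A x))"

lemma poly_charpoly: "poly (charpoly A) z = det (mat z - A)"
proof -
  have [simp]: "poly (of_int k) z = of_int k" for k :: int
    by (metis poly_const_conv of_int_poly)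
  have "poly ((if i = j then [:0, 1:] else 0) - [:A $ i $ j:]) z = (mat z - A) $ i $ j" for i j
    by (simp add: mat_def)
  then show ?thesis
    by (simp add: charpoly_def det_def poly_sum poly_prod)
qed

lemma charpoly_root_iff_eigenvector:
  fixes A :: "complex^'d^'d"
  shows "poly (charpoly A) z = 0 \<longleftrightarrow> (\<exists>v. v \<noteq> 0 \<and> A *v v = z *s v)"
proof -
  have mat_z: "mat z *v v = z *s v" for v :: "complex^'d"
    by (simp add: matrix_vector_mult_def mat_def vec_eq_iff vector_scalar_mult_def if_distrib[of "\<lambda>c. c * _"] cong: if_cong)
  have "det (mat z - A) = 0 \<longleftrightarrow> (\<exists>v. v \<noteq> 0 \<and> (mat z - A) *v v = 0)"
    using invertible_det_nz[of "mat z - A"] matrix_left_invertible_ker[of "mat z - A"]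
    by (auto simp: invertible_left_inverse)
  then show ?thesis
    by (auto simp: poly_charpoly matrix_vector_mult_diff_rdistrib mat_z)
qed

section \<open>Lebesgue and Sobolev spaces on a subset of the real line\<close>

definition Lq_fun :: "real \<Rightarrow> real set \<Rightarrow> (real \<Rightarrow> 'a::euclidean_space) \<Rightarrow> bool" where
  "Lq_fun q I f \<longleftrightarrow>
     f \<in> borel_measurable (lebesgue_on I) \<and> integrable (lebesgue_on I) (\<lambda>x. norm (f x) powr q)"

text \<open>Only meaningful for functions satisfying \<open>Lq_fun q I\<close>: a divergent integral would be 0.\<close>

definition Lq_norm :: "real \<Rightarrow> real set \<Rightarrow> (real \<Rightarrow> 'a::euclidean_space) \<Rightarrow> real" where
  "Lq_norm q I f = (LINT x|lebesgue_on I. norm (f x) powr q) powr (1 / q)"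

text \<open>\<open>C\<^sub>c\<^sup>\<infinity>(I)\<close>, with test functions extended by 0 to the real line.\<close>

definition test_functions :: "real set \<Rightarrow> (real \<Rightarrow> real) set" where
  "test_functions I =
     {\<phi>. (\<forall>k x. (deriv ^^ k) \<phi> field_differentiable at x) \<and>
          (\<exists>K. compact K \<and> K \<subseteq> I \<and> (\<forall>x. x \<notin> K \<longrightarrow> \<phi> x = 0))}"

definition locally_integrable :: "real set \<Rightarrow> (real \<Rightarrow> 'a::euclidean_space) \<Rightarrow> bool" where
  "locally_integrable I f \<longleftrightarrow> (\<forall>K. compact K \<and> K \<subseteq> I \<longrightarrow> integrable (lebesgue_on K) f)"

definition has_weak_deriv ::
  "real set \<Rightarrow> (real \<Rightarrow> 'a::euclidean_space) \<Rightarrow> (real \<Rightarrow> 'a) \<Rightarrow> bool" where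
  "has_weak_deriv I f g \<longleftrightarrow>
     locally_integrable I f \<and> locally_integrable I g \<and>
     (\<forall>\<phi>\<in>test_functions I.
        (LINT x|lebesgue_on I. deriv \<phi> x *\<^sub>R f x) = - (LINT x|lebesgue_on I. \<phi> x *\<^sub>R g x))"

text \<open>A version of the weak derivative; it is determined only up to null sets.\<close>

definition weak_deriv :: "real set \<Rightarrow> (real \<Rightarrow> 'a::euclidean_space) \<Rightarrow> real \<Rightarrow> 'a" where
  "weak_deriv I f = (SOME g. has_weak_deriv I f g)"

text \<open>A family of intervals \<open>[s, t]\<close> is encoded by its endpoint pairs \<open>(s, t)\<close>.\<close>

definition abs_continuous_on :: "real set \<Rightarrow> (real \<Rightarrow> 'a::euclidean_space) \<Rightarrow> bool" where
  "abs_continuous_on I f \<longleftrightarrow>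
     (\<forall>e>0. \<exists>\<delta>>0. \<forall>P. finite P \<longrightarrow>
        (\<forall>(s, t)\<in>P. s < t \<and> {s..t} \<subseteq> I) \<longrightarrow>
        pairwise (\<lambda>(s, t) (s', t'). {s<..<t} \<inter> {s'<..<t'} = {}) P \<longrightarrow>
        (\<Sum>(s, t)\<in>P. t - s) < \<delta> \<longrightarrow>
        (\<Sum>(s, t)\<in>P. norm (f t - f s)) < e)"

text \<open>
  \<open>W\<^sup>1\<^sup>,\<^sup>q(I, S)\<close> for \<open>I\<close> a bounded open interval: functions with values in \<open>S\<close>; every class
  is represented by its absolutely continuous member.
\<close>

definition W1q :: "real \<Rightarrow> real set \<Rightarrow> 'a set \<Rightarrow> (real \<Rightarrow> 'a::euclidean_space) set" where
  "W1q q I S =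
     {f. abs_continuous_on I f \<and> Lq_fun q I f \<and>
         (\<exists>g. has_weak_deriv I f g \<and> Lq_fun q I g) \<and> (\<forall>x\<in>I. f x \<in> S)}"

definition W1q_norm :: "real \<Rightarrow> real set \<Rightarrow> (real \<Rightarrow> 'a::euclidean_space) \<Rightarrow> real" where
  "W1q_norm q I f = Lq_norm q I f + Lq_norm q I (weak_deriv I f)"

end

theory Submission
  imports Defs
begin

text \<open>
  Almost everywhere \<open>A\<close>, \<open>A\<^sub>n\<close>, \<open>\<lambda>\<close>, \<open>\<lambda>\<^sub>n\<close> are differentiable and, along a subsequence, \<open>A\<^sub>n \<rightarrow> A\<close> and
  \<open>A\<^sub>n' \<rightarrow> A'\<close> pointwise. At such a point \<open>x\<close> one tests with polynomials, using that \<open>p(A)\<close> is normal with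
  eigenvalues \<open>p(\<lambda>)\<close>, so \<open>\<parallel>p(A)\<parallel> = \<parallel>p(\<lambda>)\<parallel>\<close> and \<open>tr p(A) = \<Sum> p(\<lambda>\<^sub>j)\<close>.

  If \<open>p\<close> vanishes and \<open>p' = 1\<close> at the eigenvalues of \<open>A(x)\<close>, then \<open>p(A)\<close> and \<open>p(\<lambda>)\<close> vanish at \<open>x\<close> and have
  equal norms nearby, whence \<open>\<parallel>\<lambda>'\<parallel> = \<parallel>p(A)'\<parallel> \<le> \<parallel>A'\<parallel>\<close>. The inequality, applied to \<open>p(A\<^sub>n)\<close> for this fixed
  \<open>p\<close>, gives \<open>limsup \<parallel>\<lambda>\<^sub>n'\<parallel> \<le> \<parallel>\<lambda>'\<parallel>\<close>.

  Almost everywhere \<open>\<lambda>\<^sub>i = \<lambda>\<^sub>j\<close> implies \<open>\<lambda>\<^sub>i' = \<lambda>\<^sub>j'\<close>, so there is a polynomial \<open>r\<close> with \<open>r'(\<lambda>\<^sub>j)\<close> the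
  conjugate of \<open>\<lambda>\<^sub>j'\<close>. Then \<open>(tr r(A\<^sub>n))' = \<Sum> r'(\<lambda>\<^sub>n\<^sub>j) \<lambda>\<^sub>n\<^sub>j'\<close> tends to \<open>\<parallel>\<lambda>'\<parallel>\<^sup>2\<close>, and Cauchy-Schwarz gives
  \<open>liminf \<parallel>\<lambda>\<^sub>n'\<parallel> \<ge> \<parallel>\<lambda>'\<parallel>\<close>. Dominated convergence and the subsequence principle conclude.
\<close>

unbundle no Formal_Power_Series.fps_syntax

section \<open>The spectral theorem for normal matrices\<close>

lemma matrix_add_rdistrib: "(A + B) ** C = A ** C + B ** (C :: 'a::semiring_1^'n^'m)"
  by (simp add: matrix_matrix_mult_def vec_eq_iff distrib_right sum.distrib)

lemma matrix_sub_ldistrib: "A ** (B - C) = A ** B - A ** (C :: 'a::ring_1^'n^'m)"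
  by (simp add: matrix_matrix_mult_def vec_eq_iff right_diff_distrib sum_subtractf)

lemma matrix_sub_rdistrib: "(A - B) ** C = A ** C - B ** (C :: 'a::ring_1^'n^'m)"
  by (simp add: matrix_matrix_mult_def vec_eq_iff left_diff_distrib sum_subtractf)

text \<open>The Hermitian inner product; the real inner product of \<open>complex^'n\<close> is only
  its real part and does not detect complex orthogonality.\<close>

definition hdot :: "complex^'n \<Rightarrow> complex^'n \<Rightarrow> complex" where
  "hdot u v = (\<Sum>i\<in>UNIV. cnj (u $ i) * v $ i)"

lemma hdot_self: "hdot v v = of_real ((norm v)\<^sup>2)"
  by (simp add: hdot_def norm_vec_def L2_set_def sum_nonneg mult.commute[of "cnj _"]
      complex_norm_square[symmetric])

lemma hdot_self_eq_0 [simp]: "hdot v v = 0 \<longleftrightarrow> v = 0"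
  by (simp add: hdot_self)

lemma hdot_zero_right [simp]: "hdot u 0 = 0"
  by (simp add: hdot_def)

lemma hdot_add_right: "hdot u (v + w) = hdot u v + hdot u w"
  by (simp add: hdot_def distrib_left sum.distrib)

lemma hdot_scale_right: "hdot u (c *s v) = c * hdot u v"
  by (simp add: hdot_def sum_distrib_left mult_ac)

lemma hdot_scale_left: "hdot (c *s u) v = cnj c * hdot u v"
  by (simp add: hdot_def sum_distrib_left mult_ac)

lemma hdot_commute: "hdot u v = cnj (hdot v u)"
  by (simp add: hdot_def mult.commute)

lemma hdot_matrix_left: "hdot (M *v u) v = hdot u (conj_transpose M *v v)"
  unfolding hdot_def conj_transpose_def matrix_vector_mult_def
  by (simp add: sum_distrib_left sum_distrib_right mult_ac) (rule sum.swap)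

lemma conj_transpose_conj_transpose [simp]: "conj_transpose (conj_transpose A) = A"
  by (simp add: conj_transpose_def vec_eq_iff)

lemma conj_transpose_mult: "conj_transpose (A ** B) = conj_transpose B ** conj_transpose A"
  by (simp add: conj_transpose_def matrix_matrix_mult_def vec_eq_iff mult.commute)

lemma conj_transpose_mat [simp]: "conj_transpose (mat c) = mat (cnj c)"
  by (auto simp: conj_transpose_def mat_def vec_eq_iff)

lemma conj_transpose_diff: "conj_transpose (A - B) = conj_transpose A - conj_transpose B"
  by (simp add: conj_transpose_def vec_eq_iff)

lemma mat_mult_vec: "mat z *v v = z *s (v :: complex^'d)"
  by (simp add: matrix_vector_mult_def mat_def vec_eq_iff vector_scalar_mult_def
      if_distrib[of "\<lambda>c. c * _"] cong: if_cong)

lemma mat_mult_entry: "(mat c ** A) $ i $ j = c * (A :: complex^'n^'m) $ i $ j"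
  by (simp add: matrix_matrix_mult_def mat_def if_distrib[of "\<lambda>c. c * _"] cong: if_cong)

lemma mult_mat_entry: "(A ** mat c) $ i $ j = c * (A :: complex^'n^'m) $ i $ j"
  by (simp add: matrix_matrix_mult_def mat_def if_distrib[of "\<lambda>c. _ * c"] mult.commute cong: if_cong)

lemma mat_mult_commute: "mat c ** A = A ** mat c" for A :: "complex^'d^'d"
  by (simp add: vec_eq_iff mat_mult_entry mult_mat_entry)

lemma matrix_vector_mult_scale: "A *v (c *s v) = c *s (A *v v)" for A :: "complex^'n^'m"
  by (simp add: vec_eq_iff matrix_vector_mult_def sum_distrib_left mult_ac)

text \<open>The matrix \<open>N = A - mat z\<close> is normal too, so \<open>N *v w\<close> and
  \<open>conj_transpose N *v w\<close> have equal norms; one vanishes if the other does.\<close>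

lemma normal_eigenvector_adjoint:
  assumes A: "A \<in> normal_matrices" and w: "A *v w = z *s w"
  shows "conj_transpose A *v w = cnj z *s w"
proof -
  define N where "N = A - mat z"
  have cN: "conj_transpose N = conj_transpose A - mat (cnj z)"
    by (simp add: N_def conj_transpose_diff)
  have "conj_transpose N ** N = N ** conj_transpose N"
    using A unfolding cN unfolding N_def normal_matrices_def
    by (simp add: matrix_sub_ldistrib matrix_sub_rdistrib mat_mult_commute[of _ A]
        mat_mult_commute[of _ "conj_transpose A"] mat_mult_commute[of z "mat (cnj z)"])
  then have "hdot (conj_transpose N *v w) (conj_transpose N *v w) = hdot (N *v w) (N *v w)"
    by (simp add: hdot_matrix_left matrix_vector_mul_assoc)
  also have "\<dots> = 0"
    by (simp add: N_def matrix_vector_mult_diff_rdistrib w mat_mult_vec)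
  finally show ?thesis
    by (simp add: cN matrix_vector_mult_diff_rdistrib mat_mult_vec)
qed

section \<open>Polynomials of a matrix\<close>

definition poly_mat :: "complex poly \<Rightarrow> complex^'d^'d \<Rightarrow> complex^'d^'d" where
  "poly_mat p A = fold_coeffs (\<lambda>c M. mat c + A ** M) p 0"

lemma mat_0 [simp]: "mat 0 = 0"
  by (simp add: mat_def vec_eq_iff)

lemma poly_mat_0 [simp]: "poly_mat 0 A = 0"
  by (simp add: poly_mat_def)

lemma poly_mat_pCons [simp]: "poly_mat (pCons c p) A = mat c + A ** poly_mat p A"
  \<comment> \<open>\<open>pCons 0 0\<close> is the zero polynomial, which the fold passes over; the
    recursion survives because \<open>mat 0 + A ** 0\<close> is zero as well.\<close>
  by (cases "p = 0 \<and> c = 0") (auto simp: poly_mat_def)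

lemma mat_add: "mat (a + b) = mat a + (mat b :: complex^'d^'d)"
  by (simp add: mat_def vec_eq_iff)

lemma mat_mult: "mat (a * b) = mat a ** (mat b :: complex^'d^'d)"
  by (auto simp: vec_eq_iff mat_mult_entry) (auto simp: mat_def)

lemma poly_mat_add: "poly_mat (p + q) A = poly_mat p A + poly_mat q A"
proof (induction p arbitrary: q)
  case (pCons a p)
  then show ?case
    by (cases q) (simp add: mat_add matrix_add_ldistrib)
qed simp

lemma poly_mat_smult: "poly_mat (smult c p) A = mat c ** poly_mat p A"
proof (induction p)
  case (pCons a p)
  have "A ** (mat c ** poly_mat p A) = mat c ** (A ** poly_mat p A)"
    by (metis mat_mult_commute matrix_mul_assoc)
  with pCons show ?case
    by (simp add: mat_mult matrix_add_ldistrib)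
qed simp

lemma poly_mat_mult: "poly_mat (p * q) A = poly_mat p A ** poly_mat q A"
proof (induction p)
  case (pCons a p)
  then show ?case
    by (simp add: poly_mat_add poly_mat_smult matrix_add_rdistrib matrix_mul_assoc)
qed simp

lemma poly_mat_sum: "poly_mat (\<Sum>i\<in>S. f i) A = (\<Sum>i\<in>S. poly_mat (f i) A)"
  by (induction S rule: infinite_finite_induct) (auto simp: poly_mat_add)

section \<open>Eigenvectors from annihilating polynomials\<close>

lemma poly_mat_monom_vec: "poly_mat (monom c k) A *v v = c *s ((\<lambda>w. A *v w) ^^ k) v"
  by (induction k)
    (simp_all add: monom_0 monom_Suc mat_mult_vec matrix_vector_mul_assoc[symmetric] matrix_vector_mult_scale)

lemma sum_mult_vec: "(\<Sum>i\<in>S. f i) *v v = (\<Sum>i\<in>S. f i *v v)" for f :: "_ \<Rightarrow> complex^'n^'m"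
  by (induction S rule: infinite_finite_induct) (auto simp: matrix_vector_mult_add_rdistrib)

text \<open>Consider the iterates of \<open>v\<close> under \<open>A\<close>. If two of them
  coincide, a difference of two monomials annihilates \<open>v\<close>. Otherwise they are
  infinitely many vectors in a finite-dimensional space, and a linear dependence between them
  supplies the coefficients of \<open>p\<close>.\<close>

lemma ex_annihilating_poly:
  fixes A :: "complex^'d^'d"
  obtains p where "p \<noteq> 0" "poly_mat p A *v v = 0"
proof (cases "inj (\<lambda>k. ((\<lambda>w. A *v w) ^^ k) v)")
  case False
  then obtain j k where jk: "j \<noteq> k" "((\<lambda>w. A *v w) ^^ j) v = ((\<lambda>w. A *v w) ^^ k) v"
    by (auto simp: inj_def)
  show thesis
  proof
    have "coeff (monom 1 j + monom (-1) k) j = (1::complex)"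
      using jk by simp
    then show "monom 1 j + monom (-1) k \<noteq> (0 :: complex poly)"
      by (metis coeff_0 zero_neq_one)
    show "poly_mat (monom 1 j + monom (-1) k) A *v v = 0"
      using jk by (simp add: poly_mat_add matrix_vector_mult_add_rdistrib poly_mat_monom_vec)
  qed
next
  case inj: True
  let ?u = "\<lambda>k. ((\<lambda>w. A *v w) ^^ k) v"
  have "infinite (range ?u)"
    using inj by (simp add: finite_image_iff)
  then have "vec.dependent (range ?u)"
    using vec.finiteI_independent by blast
  then obtain T c where T: "finite T" "T \<subseteq> range ?u" "(\<Sum>x\<in>T. c x *s x) = 0" "\<exists>x\<in>T. c x \<noteq> 0"
    unfolding vec.dependent_explicit by blast
  define K where "K = ?u -` T"
  have K: "finite K" "?u ` K = T" "inj_on ?u K"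
    using T inj unfolding K_def by (auto intro: finite_vimageI inj_on_subset)
  define p where "p = (\<Sum>k\<in>K. monom (c (?u k)) k)"
  obtain k where k: "k \<in> K" "c (?u k) \<noteq> 0"
    using T K by auto
  show thesis
  proof
    have "coeff p k = c (?u k)"
      using K k by (simp add: p_def coeff_sum)
    then show "p \<noteq> 0" using k by auto
    show "poly_mat p A *v v = 0"
      using T(3) sum.reindex[OF K(3), of "\<lambda>x. c x *s x"] K(2)
      by (simp add: p_def poly_mat_sum sum_mult_vec poly_mat_monom_vec)
  qed
qed

text \<open>Take an annihilating polynomial \<open>p\<close> of \<open>v\<close> of least degree and
  split off a linear factor, p = (X - z) q. Then w = q(A) v is nonzero by minimality, lies in
  \<open>S\<close> by invariance, and is annihilated by A - z.\<close>

lemma ex_eigenvector_in_invariant_subspace: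
  fixes A :: "complex^'d^'d"
  assumes S: "vec.subspace S" and inv: "\<And>w. w \<in> S \<Longrightarrow> A *v w \<in> S" and v: "v \<in> S" "v \<noteq> 0"
  obtains w z where "w \<in> S" "w \<noteq> 0" "A *v w = z *s w"
proof -
  obtain p0 where "p0 \<noteq> 0 \<and> poly_mat p0 A *v v = 0"
    using ex_annihilating_poly by metis
  from ex_has_least_nat[of "\<lambda>p. p \<noteq> 0 \<and> poly_mat p A *v v = 0", OF this, of degree]
  obtain p where p: "p \<noteq> 0" "poly_mat p A *v v = 0"
    and min: "\<And>q. q \<noteq> 0 \<Longrightarrow> poly_mat q A *v v = 0 \<Longrightarrow> degree p \<le> degree q"
    by blast
  have "degree p \<noteq> 0"
  proof
    assume "degree p = 0"
    then obtain c where c: "p = [:c:]"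
      by (meson degree_eq_zeroE)
    with p v show False
      by (simp add: mat_mult_vec)
  qed
  then obtain z where "poly p z = 0"
    using fundamental_theorem_of_algebra[of p] by (auto simp: constant_degree)
  then obtain q where q: "p = [:-z, 1:] * q"
    by (metis dvd_def poly_eq_0_iff_dvd)
  with p have "q \<noteq> 0" by auto
  then have "degree q < degree p"
    using q by (simp add: degree_mult_eq del: mult_pCons_left)
  with min \<open>q \<noteq> 0\<close> have ne: "poly_mat q A *v v \<noteq> 0"
    by (meson leD)
  have inS: "poly_mat r A *v v \<in> S" for r
  proof (induction r)
    case 0
    then show ?case using S by (simp add: vec.subspace_0)
  next
    case (pCons c r)
    then show ?case
      using S v inv by (simp add: matrix_vector_mult_add_rdistrib mat_mult_vec
          matrix_vector_mul_assoc[symmetric] vec.subspace_add vec.subspace_scale)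
  qed
  have "poly_mat [:-z, 1:] A *v (poly_mat q A *v v) = 0"
    using p q by (simp add: matrix_vector_mul_assoc poly_mat_mult del: poly_mat_pCons mult_pCons_left)
  then have "(-z) *s (poly_mat q A *v v) + A *v (poly_mat q A *v v) = 0"
    by (simp add: matrix_vector_mult_add_rdistrib mat_mult_vec)
  then have "A *v (poly_mat q A *v v) = z *s (poly_mat q A *v v)"
    by (simp add: vec.scale_minus_left)
  with that inS ne show thesis by blast
qed

text \<open>Induction on \<open>J\<close>: the vectors orthogonal to the eigenvectors already found
  form an invariant subspace, because these are eigenvectors of the adjoint as well. A unit
  eigenvector from that subspace is added.\<close>

lemma ex_orthonormal_eigenvectors:
  fixes A :: "complex^'d^'d"
  fixes J :: "'d set"
  assumes A: "A \<in> normal_matrices"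
  shows "\<exists>e. (\<forall>i\<in>J. \<forall>j\<in>J. hdot (e i) (e j) = (if i = j then 1 else 0)) \<and>
             (\<forall>j\<in>J. \<exists>z. A *v e j = z *s e j)"
using finite[of J]
proof (induction J rule: finite_induct)
  case (insert k J)
  then obtain e where e: "\<And>i j. i \<in> J \<Longrightarrow> j \<in> J \<Longrightarrow> hdot (e i) (e j) = (if i = j then 1 else 0)"
     "\<And>j. j \<in> J \<Longrightarrow> \<exists>z. A *v e j = z *s e j" by metis
  define S where "S = {v. \<forall>j\<in>J. hdot (e j) v = 0}"
  have S: "vec.subspace S"
    by (auto simp: S_def vec.subspace_def hdot_add_right hdot_scale_right)
  have inv: "A *v w \<in> S" if "w \<in> S" for w
    unfolding S_def mem_Collect_eq
  proof
    fix j assume j: "j \<in> J"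
    then obtain z where "A *v e j = z *s e j"
      using e by blast
    then have "conj_transpose A *v e j = cnj z *s e j"
      using normal_eigenvector_adjoint[OF A] by blast
    then have "hdot (e j) (A *v w) = z * hdot (e j) w"
      using hdot_matrix_left[of "conj_transpose A" "e j" w] by (simp add: hdot_scale_left)
    then show "hdot (e j) (A *v w) = 0"
      using that j by (simp add: S_def)
  qed
  define M :: "complex^'d^'d" where "M = (\<chi> i j. if i \<in> J then cnj (e i $ j) else 0)"
  have "row k M = 0"
    using \<open>k \<notin> J\<close> by (simp add: row_def M_def vec_eq_iff)
  then have "det M = 0"
    using det_zero_row by blast
  then have "\<not> (\<exists>B. B ** M = mat 1)"
    using invertible_det_nz[of M] invertible_left_inverse[of M] by blast
  then obtain v where v: "M *v v = 0" "v \<noteq> 0"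
    using matrix_left_invertible_ker[of M] by blast
  have "v \<in> S"
    unfolding S_def mem_Collect_eq
  proof
    fix j assume "j \<in> J"
    then have "hdot (e j) v = (M *v v) $ j"
      by (simp add: hdot_def M_def matrix_vector_mult_def)
    with v show "hdot (e j) v = 0" by simp
  qed
  obtain w z where w: "w \<in> S" "w \<noteq> 0" "A *v w = z *s w"
    using ex_eigenvector_in_invariant_subspace[OF S inv \<open>v \<in> S\<close> \<open>v \<noteq> 0\<close>] by blast
  define u where "u = of_real (1 / norm w) *s w"
  have u1: "hdot u u = 1"
    using w unfolding u_def hdot_scale_left hdot_scale_right hdot_self[of w] by (simp add: power2_eq_square)
  have uS: "hdot (e j) u = 0" if "j \<in> J" for j
    using w that by (simp add: u_def hdot_scale_right S_def)
  then have uS': "hdot u (e j) = 0" if "j \<in> J" for j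
    using that hdot_commute[of u "e j"] by simp
  have uz: "A *v u = z *s u"
    by (simp add: u_def matrix_vector_mult_scale w mult.commute)
  define e' where "e' = e(k := u)"
  have "e' j = e j" if "j \<in> J" for j
    using that \<open>k \<notin> J\<close> by (auto simp: e'_def)
  moreover have "e' k = u" by (simp add: e'_def)
  ultimately show ?case
    using e u1 uS uS' uz \<open>k \<notin> J\<close> by (intro exI[of _ e']) auto
qed auto

section \<open>Unitary diagonalization and the multiset of eigenvalues\<close>

definition diag_mat :: "complex^'d \<Rightarrow> complex^'d^'d" where
  "diag_mat l = (\<chi> i j. if i = j then l $ i else 0)"

definition unitary :: "complex^'d^'d \<Rightarrow> bool" where
  "unitary U \<longleftrightarrow> conj_transpose U ** U = mat 1"

text \<open>The order of the entries of \<open>l\<close> is part of the data, since \<open>l\<close>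
  will be the value of a given parameterization. The unitary matrix is hidden: no regularity in
  \<open>x\<close> is ever asked of it.\<close>

definition unitarily_diag :: "complex^'d^'d \<Rightarrow> complex^'d \<Rightarrow> bool" where
  "unitarily_diag A l \<longleftrightarrow> (\<exists>U. unitary U \<and> A = U ** diag_mat l ** conj_transpose U)"

lemma unitaryD:
  assumes "unitary U"
  shows "conj_transpose U ** U = mat 1" "U ** conj_transpose U = mat 1"
  using assms matrix_left_right_inverse[of U "conj_transpose U"] by (auto simp: unitary_def)

lemma mult_diag_mat_entry: "(M ** diag_mat l) $ i $ j = M $ i $ j * l $ j"
  by (simp add: matrix_matrix_mult_def diag_mat_def if_distrib[of "\<lambda>c. _ * c"] cong: if_cong)

lemma diag_mat_mult_entry: "(diag_mat l ** M) $ i $ j = l $ i * M $ i $ j"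
  by (simp add: matrix_matrix_mult_def diag_mat_def if_distrib[of "\<lambda>c. c * _"] cong: if_cong)

lemma normal_unitarily_diag:
  fixes A :: "complex^'d^'d"
  assumes A: "A \<in> normal_matrices"
  obtains l where "unitarily_diag A l"
proof -
  obtain e :: "'d \<Rightarrow> complex^'d" where e: "\<And>i j. hdot (e i) (e j) = (if i = j then 1 else 0)"
    and "\<And>j. \<exists>z. A *v e j = z *s e j"
    using ex_orthonormal_eigenvectors[OF A, of UNIV] by auto
  then obtain l where l: "\<And>j. A *v e j = l j *s e j" by metis
  define U where "U = (\<chi> i j. e j $ i)"
  have U: "unitary U"
    using e by (simp add: unitary_def vec_eq_iff conj_transpose_def matrix_matrix_mult_def U_def
        hdot_def mat_def)
  have "A ** U = U ** diag_mat (vec_lambda l)"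
  proof -
    have "(A ** U) $ i $ j = (A *v e j) $ i" for i j
      by (simp add: matrix_matrix_mult_def matrix_vector_mult_def U_def)
    then show ?thesis
      by (simp add: vec_eq_iff l mult_diag_mat_entry) (simp add: U_def)
  qed
  then have "A = U ** diag_mat (vec_lambda l) ** conj_transpose U"
    by (metis U matrix_mul_assoc matrix_mul_rid unitaryD(2))
  with U that show thesis
    unfolding unitarily_diag_def by blast
qed

text \<open>Unitary conjugation preserves \<open>det (mat z - A)\<close>, so
  \<open>charpoly A\<close> takes the same value as the product of the linear factors at every
  \<open>z\<close>, which makes the polynomials equal.\<close>

lemma eigenvalues_unitarily_diag:
  fixes l :: "complex^'d"
  assumes "unitarily_diag A l"
  shows "eigenvalues A = image_mset (\<lambda>i. l $ i) (mset_set UNIV)"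
proof -
  obtain U where U: "unitary U" and A: "A = U ** diag_mat l ** conj_transpose U"
    using assms by (auto simp: unitarily_diag_def)
  have "poly (charpoly A) z = poly (\<Prod>i\<in>UNIV. [:- l $ i, 1:]) z" for z
  proof -
    have "mat z - A = U ** (mat z - diag_mat l) ** conj_transpose U"
      using unitaryD[OF U] by (simp add: A matrix_sub_ldistrib matrix_sub_rdistrib
        mat_mult_commute[of z U, symmetric] matrix_mul_assoc[symmetric])
    then have "det (mat z - A) = det (mat z - diag_mat l) * det (U ** conj_transpose U)"
      by (simp add: det_mul)
    also have "\<dots> = det (mat z - diag_mat l)"
      using unitaryD[OF U] by simp
    also have "\<dots> = (\<Prod>i\<in>UNIV. z - l $ i)"
      by (subst det_diagonal) (auto simp: mat_def diag_mat_def)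
    finally show ?thesis by (simp add: poly_charpoly poly_prod)
  qed
  then have "charpoly A = (\<Prod>i\<in>UNIV. [:- l $ i, 1:])"
    by (metis poly_eq_poly_eq_iff ext)
  then have "eigenvalues A = (\<Sum>i\<in>UNIV. {#l $ i#})"
    by (simp add: eigenvalues_def proots_prod)
  then show ?thesis
    by (simp add: sum_unfold_sum_mset)
qed

text \<open>Two enumerations of one multiset differ by a permutation, which is realized by permuting
  the columns of the diagonalizing matrix. So any parameterization of the eigenvalues may stand on
  the diagonal, whatever order it chooses at each point.\<close>

lemma unitarily_diag_eigenvalues:
  fixes l :: "complex^'d"
  assumes A: "A \<in> normal_matrices" and l: "image_mset (\<lambda>i. l $ i) (mset_set UNIV) = eigenvalues A"
  shows "unitarily_diag A l"
proof -
  obtain m where m: "unitarily_diag A m"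
    using normal_unitarily_diag[OF A] by blast
  then have "image_mset (\<lambda>i. l $ i) (mset_set UNIV) = image_mset (\<lambda>i. m $ i) (mset_set UNIV)"
    using l eigenvalues_unitarily_diag by metis
  then obtain p where p: "p permutes UNIV" "\<And>i. l $ i = m $ p i"
    using image_mset_eq_implies_permutes[of UNIV "\<lambda>i. l $ i" "\<lambda>i. m $ i"] by auto
  have inj: "inj p" "bij p" using p by (auto simp: permutes_inj permutes_bij)
  obtain U where U: "unitary U" and AU: "A = U ** diag_mat m ** conj_transpose U"
    using m by (auto simp: unitarily_diag_def)
  define V where "V = (\<chi> i j. U $ i $ p j)"
  have "unitary V"
    unfolding unitary_def vec_eq_iff
  proof (intro allI)
    fix i j
    have "(conj_transpose V ** V) $ i $ j = (conj_transpose U ** U) $ p i $ p j"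
      by (simp add: V_def conj_transpose_def matrix_matrix_mult_def)
    also have "\<dots> = mat 1 $ i $ j"
      using inj by (simp add: unitaryD(1)[OF U] mat_def inj_eq)
    finally show "(conj_transpose V ** V) $ i $ j = mat 1 $ i $ j" .
  qed
  moreover have "A = V ** diag_mat l ** conj_transpose V"
  proof -
    have entry: "(W ** diag_mat n ** conj_transpose W) $ i $ j
        = (\<Sum>k\<in>UNIV. (W $ i $ k * n $ k) * cnj (W $ j $ k))" for W :: "complex^'d^'d" and n i j
      by (simp add: matrix_matrix_mult_def[of "W ** diag_mat n"] mult_diag_mat_entry conj_transpose_def)
    have "(U ** diag_mat m ** conj_transpose U) $ i $ j = (V ** diag_mat l ** conj_transpose V) $ i $ j" for i j
      using sum.reindex_bij_betw[OF inj(2), of "\<lambda>k. (U $ i $ k * m $ k) * cnj (U $ j $ k)"]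
      by (simp add: entry V_def p(2))
    then show ?thesis
      unfolding AU vec_eq_iff by blast
  qed
  ultimately show ?thesis
    unfolding unitarily_diag_def by blast
qed

section \<open>Polynomials of differentiable normal matrices\<close>

lemma bounded_bilinear_matrix_mult:
  "bounded_bilinear ((**) :: complex^'n^'m \<Rightarrow> complex^'k^'n \<Rightarrow> complex^'k^'m)"
proof -
  have "bilinear ((**) :: complex^'n^'m \<Rightarrow> complex^'k^'n \<Rightarrow> complex^'k^'m)"
    by (auto simp: bilinear_def matrix_add_ldistrib matrix_add_rdistrib intro!: linearI)
      (simp_all add: matrix_matrix_mult_def vec_eq_iff scaleR_sum_right)
  then show ?thesis by (simp add: bilinear_conv_bounded_bilinear)
qed

section \<open>Unitary invariance of the Frobenius norm and of the trace\<close>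

lemma norm_sq_columns: "(norm M)\<^sup>2 = (\<Sum>j\<in>UNIV. (norm (column j M))\<^sup>2)" for M :: "complex^'n^'m"
  unfolding norm_matrix_Frobenius column_def norm_vec_def L2_set_def
  by (simp add: sum_nonneg) (rule sum.swap)

lemma norm_unitary_vec:
  assumes "unitary U"
  shows "norm (U *v v) = norm v"
proof -
  have "complex_of_real ((norm (U *v v))\<^sup>2) = of_real ((norm v)\<^sup>2)"
    unfolding hdot_self[symmetric]
    by (simp add: hdot_matrix_left matrix_vector_mul_assoc unitaryD[OF assms])
  then have "(norm (U *v v))\<^sup>2 = (norm v)\<^sup>2"
    using of_real_eq_iff by blast
  then show ?thesis by simp
qed

lemma norm_unitary_mult:
  assumes "unitary U"
  shows "norm (U ** M) = norm M"
proof -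
  have "column j (U ** M) = U *v column j M" for j
    by (simp add: vec_eq_iff column_def matrix_matrix_mult_def matrix_vector_mult_def)
  then have "(norm (U ** M))\<^sup>2 = (norm M)\<^sup>2"
    by (simp add: norm_sq_columns norm_unitary_vec[OF assms])
  then show ?thesis by simp
qed

lemma norm_conj_transpose [simp]: "norm (conj_transpose M) = norm M"
  unfolding norm_matrix_Frobenius conj_transpose_def by (simp, subst sum.swap) simp

lemma norm_mult_unitary:
  assumes "unitary U"
  shows "norm (M ** conj_transpose U) = norm M"
  by (metis assms conj_transpose_conj_transpose conj_transpose_mult norm_conj_transpose norm_unitary_mult)

lemma norm_diag_mat: "norm (diag_mat l) = norm l"
proof -
  have "(\<Sum>j\<in>UNIV. (cmod (diag_mat l $ i $ j))\<^sup>2) = (cmod (l $ i))\<^sup>2" for i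
    by (simp add: diag_mat_def if_distrib[of "\<lambda>c. (cmod c)\<^sup>2"] cong: if_cong)
  then show ?thesis
    by (simp add: norm_matrix_Frobenius) (simp add: norm_vec_def L2_set_def)
qed

lemma norm_unitarily_diag: "unitarily_diag A l \<Longrightarrow> norm A = norm l"
  by (auto simp: unitarily_diag_def norm_mult_unitary norm_unitary_mult norm_diag_mat)

lemma trace_unitarily_diag:
  assumes "unitarily_diag A l"
  shows "trace A = (\<Sum>i\<in>UNIV. l $ i)"
proof -
  obtain U where U: "unitary U" and A: "A = U ** diag_mat l ** conj_transpose U"
    using assms by (auto simp: unitarily_diag_def)
  have "trace A = trace (diag_mat l ** conj_transpose U ** U)"
    unfolding A by (metis matrix_mul_assoc trace_mul_sym)
  also have "\<dots> = trace (diag_mat l)"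
    by (simp add: matrix_mul_assoc[symmetric] unitaryD[OF U])
  finally show ?thesis
    by (simp add: trace_def diag_mat_def)
qed

section \<open>Polynomials of diagonalized matrices\<close>

definition poly_vec :: "complex poly \<Rightarrow> complex^'d \<Rightarrow> complex^'d" where
  "poly_vec p l = (\<chi> i. poly p (l $ i))"

lemma poly_mat_diag: "poly_mat p (diag_mat l) = diag_mat (poly_vec p l)"
proof (induction p)
  case 0
  then show ?case by (simp add: diag_mat_def poly_vec_def vec_eq_iff)
next
  case (pCons c p)
  then show ?case
    by (simp add: vec_eq_iff diag_mat_mult_entry) (simp add: diag_mat_def poly_vec_def mat_def)
qed

lemma poly_mat_conj:
  assumes U: "unitary U"
  shows "poly_mat p (U ** M ** conj_transpose U) = U ** poly_mat p M ** conj_transpose U"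
proof (induction p)
  case 0
  then show ?case by (simp add: matrix_matrix_mult_def vec_eq_iff)
next
  case (pCons c p)
  have "U ** M ** conj_transpose U ** (U ** poly_mat p M ** conj_transpose U)
      = U ** M ** (conj_transpose U ** U) ** poly_mat p M ** conj_transpose U"
    by (simp add: matrix_mul_assoc)
  moreover have "U ** mat c ** conj_transpose U = mat c"
    using unitaryD[OF U] by (simp add: mat_mult_commute[of c U, symmetric] matrix_mul_assoc[symmetric])
  ultimately show ?case
    using pCons unitaryD[OF U]
    by (simp add: matrix_add_ldistrib matrix_add_rdistrib matrix_mul_assoc)
qed

text \<open>The same unitary matrix diagonalizes \<open>A\<close> and \<open>poly_mat p A\<close>,
  so the order of the eigenvalues is kept.\<close>

lemma unitarily_diag_poly:
  assumes "unitarily_diag A l"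
  shows "unitarily_diag (poly_mat p A) (poly_vec p l)"
  using assms by (auto simp: unitarily_diag_def poly_mat_conj poly_mat_diag)

text \<open>The derivative of \<open>poly_mat p\<close> at \<open>A\<close> in the direction
  \<open>B\<close>. Horner's scheme runs on pairs of a value and a derivative, as with dual numbers,
  and the second component follows the product rule.\<close>

definition dpoly_mat :: "complex poly \<Rightarrow> complex^'d^'d \<Rightarrow> complex^'d^'d \<Rightarrow> complex^'d^'d" where
  "dpoly_mat p A B =
     snd (fold_coeffs (\<lambda>c X. (mat c + A ** fst X, B ** fst X + A ** snd X)) p (0, 0))"

lemma dpoly_mat_0 [simp]: "dpoly_mat 0 A B = 0"
  by (simp add: dpoly_mat_def)

lemma dpoly_mat_pCons [simp]:
  "dpoly_mat (pCons c p) A B = B ** poly_mat p A + A ** dpoly_mat p A B"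
proof -
  let ?F = "\<lambda>c X. (mat c + A ** fst X, B ** fst X + A ** snd X)"
  have F: "fold_coeffs ?F (pCons c p) (0, 0) = ?F c (fold_coeffs ?F p (0, 0))" for c p
    by (cases "p = 0 \<and> c = 0") (auto simp: matrix_matrix_mult_def zero_vec_def)
  have "fst (fold_coeffs ?F p (0, 0)) = poly_mat p A"
    by (induction p) (simp_all add: F)
  then show ?thesis
    by (simp add: dpoly_mat_def F)
qed

lemma poly_mat_has_vector_derivative:
  assumes "(A has_vector_derivative B) (at x within S)"
  shows "((\<lambda>t. poly_mat p (A t)) has_vector_derivative dpoly_mat p (A x) B) (at x within S)"
proof (induction p)
  case (pCons c p)
  show ?case
    using has_vector_derivative_add[OF has_vector_derivative_const
        bounded_bilinear.has_vector_derivative[OF bounded_bilinear_matrix_mult assms pCons.IH]]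
    by (simp add: add.commute)
qed simp

lemma tendsto_poly_mat:
  assumes "(A \<longlongrightarrow> A0) F"
  shows "((\<lambda>n. poly_mat p (A n)) \<longlongrightarrow> poly_mat p A0) F"
  by (induction p) (auto intro!: tendsto_add assms bounded_bilinear.tendsto[OF bounded_bilinear_matrix_mult])

lemma tendsto_dpoly_mat:
  assumes "(A \<longlongrightarrow> A0) F" "(B \<longlongrightarrow> B0) F"
  shows "((\<lambda>n. dpoly_mat p (A n) (B n)) \<longlongrightarrow> dpoly_mat p A0 B0) F"
  by (induction p) (auto intro!: tendsto_add assms tendsto_poly_mat
      bounded_bilinear.tendsto[OF bounded_bilinear_matrix_mult])

lemma tendsto_trace:
  fixes A :: "'b \<Rightarrow> complex^'d^'d"
  assumes "(A \<longlongrightarrow> A0) F"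
  shows "((\<lambda>n. trace (A n)) \<longlongrightarrow> trace A0) F"
  unfolding trace_def by (intro tendsto_sum tendsto_vec_nth assms)

lemma trace_has_vector_derivative:
  fixes A :: "real \<Rightarrow> complex^'d^'d"
  assumes "(A has_vector_derivative B) (at x within S)"
  shows "((\<lambda>t. trace (A t)) has_vector_derivative trace B) (at x within S)"
  unfolding trace_def
  by (intro has_vector_derivative_sum bounded_linear.has_vector_derivative[OF bounded_linear_vec_nth] assms)

text \<open>In an eigenbasis the derivative of \<open>p(A)\<close> in direction \<open>B\<close> is the entrywise product of \<open>B\<close>
  with the divided differences of \<open>p\<close> at the eigenvalues, which are stated here without division.\<close>

lemma dpoly_mat_diag_entry:
  "(l $ i - l $ j) * dpoly_mat p (diag_mat l) B $ i $ j = (poly p (l $ i) - poly p (l $ j)) * B $ i $ j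
   \<and> (l $ i = l $ j \<longrightarrow> dpoly_mat p (diag_mat l) B $ i $ j = poly (pderiv p) (l $ i) * B $ i $ j)"
proof (induction p)
  case (pCons c p)
  have *: "dpoly_mat (pCons c p) (diag_mat l) B $ i $ j =
      B $ i $ j * poly p (l $ j) + l $ i * dpoly_mat p (diag_mat l) B $ i $ j"
    by (simp add: poly_mat_diag mult_diag_mat_entry diag_mat_mult_entry) (simp add: poly_vec_def)
  let ?D = "dpoly_mat p (diag_mat l) B $ i $ j"
  have "(l $ i - l $ j) * (B $ i $ j * poly p (l $ j) + l $ i * ?D)
      = (l $ i - l $ j) * B $ i $ j * poly p (l $ j) + l $ i * ((l $ i - l $ j) * ?D)"
    by (simp add: algebra_simps)
  also have "\<dots> = (poly (pCons c p) (l $ i) - poly (pCons c p) (l $ j)) * B $ i $ j"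
    unfolding conjunct1[OF pCons.IH] by (simp add: algebra_simps)
  finally show ?case
    unfolding * using conjunct2[OF pCons.IH] by (auto simp: algebra_simps pderiv_pCons)
qed simp

lemma dpoly_mat_conj:
  assumes U: "unitary U"
  shows "dpoly_mat p (U ** M ** conj_transpose U) (U ** B ** conj_transpose U)
       = U ** dpoly_mat p M B ** conj_transpose U"
proof (induction p)
  case 0
  then show ?case by (simp add: matrix_matrix_mult_def vec_eq_iff)
next
  case (pCons c p)
  have "U ** X ** conj_transpose U ** (U ** Y ** conj_transpose U)
      = U ** X ** (conj_transpose U ** U) ** Y ** conj_transpose U" for X Y
    by (simp add: matrix_mul_assoc)
  then show ?case
    using pCons unitaryD[OF U]
    by (simp add: poly_mat_conj[OF U] matrix_add_ldistrib matrix_add_rdistrib matrix_mul_assoc)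
qed

text \<open>In an eigenbasis the entries of \<open>B\<close> are multiplied by divided differences
  of \<open>p\<close>: 0 for distinct eigenvalues, as \<open>p\<close> vanishes at both, and 1 for
  equal ones. Deleting entries does not increase the Frobenius norm.\<close>

lemma norm_dpoly_mat_le:
  assumes A: "unitarily_diag A l"
    and p: "\<And>i. poly p (l $ i) = 0" "\<And>i. poly (pderiv p) (l $ i) = 1"
  shows "norm (dpoly_mat p A B) \<le> norm B"
proof -
  obtain U where U: "unitary U" and A: "A = U ** diag_mat l ** conj_transpose U"
    using A by (auto simp: unitarily_diag_def)
  define C where "C = conj_transpose U ** B ** U"
  have "U ** C ** conj_transpose U = (U ** conj_transpose U) ** B ** (U ** conj_transpose U)"
    by (simp add: C_def matrix_mul_assoc)
  then have B: "B = U ** C ** conj_transpose U"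
    by (simp add: unitaryD[OF U])
  have "cmod (dpoly_mat p (diag_mat l) C $ i $ j) \<le> cmod (C $ i $ j)" for i j
    using dpoly_mat_diag_entry[of l i j p C] p by (cases "l $ i = l $ j") auto
  then have "norm (dpoly_mat p (diag_mat l) C) \<le> norm C"
    by (intro norm_le_componentwise_cart)
  then show ?thesis
    unfolding A B dpoly_mat_conj[OF U] by (simp add: norm_mult_unitary[OF U] norm_unitary_mult[OF U])
qed

text \<open>Induction on the nodes. The correction is a linear polynomial times the square of
  \<open>w\<close>, which vanishes to second order at the old nodes; \<open>s\<close> and
  \<open>t\<close> are solved for from the value and the derivative at the new node
  \<open>u\<close>.\<close>

lemma Hermite_interpolation:
  fixes f g :: "'a::field \<Rightarrow> 'a"
  assumes "finite M"
  shows "\<exists>p. \<forall>z\<in>M. poly p z = f z \<and> poly (pderiv p) z = g z"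
  using assms
proof (induction M)
  case (insert u M)
  then obtain p where p: "\<And>z. z \<in> M \<Longrightarrow> poly p z = f z" "\<And>z. z \<in> M \<Longrightarrow> poly (pderiv p) z = g z"
    by blast
  define w where "w = (\<Prod>z\<in>M. [:-z, 1:])"
  have w0: "poly w z = 0" if "z \<in> M" for z
    using that insert by (auto simp: w_def poly_prod)
  have wu: "poly w u \<noteq> 0"
    using insert by (auto simp: w_def poly_prod)
  define s where "s = (f u - poly p u) / (poly w u)\<^sup>2"
  define t where "t = (g u - poly (pderiv p) u - 2 * poly w u * poly (pderiv w) u * s) / (poly w u)\<^sup>2"
  define q where "q = p + w * w * [:s - t * u, t:]"
  have q: "poly q z = poly p z + (poly w z)\<^sup>2 * (s + t * (z - u))"
    "poly (pderiv q) z = poly (pderiv p) z + 2 * poly w z * poly (pderiv w) z * (s + t * (z - u)) + (poly w z)\<^sup>2 * t" for z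
    by (simp_all add: q_def pderiv_add pderiv_mult pderiv_pCons pderiv_smult algebra_simps power2_eq_square)
  show ?case
    using p w0 wu by (intro exI[of _ q]) (auto simp: q s_def t_def)
qed auto

section \<open>Difference quotients and norms of derivatives\<close>

lemma has_vector_derivative_iff_quotient:
  "(f has_vector_derivative f') (at x) \<longleftrightarrow> ((\<lambda>y. (f y - f x) /\<^sub>R (y - x)) \<longlongrightarrow> f') (at x)"
proof -
  have "norm (f y - f x - (y - x) *\<^sub>R f') / norm (y - x) = norm ((f y - f x) /\<^sub>R (y - x) - f')"
    if "y \<noteq> x" for y
  proof -
    have "(f y - f x) /\<^sub>R (y - x) - f' = (f y - f x - (y - x) *\<^sub>R f') /\<^sub>R (y - x)"
      using that by (simp add: scaleR_right_diff_distrib)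
    then show ?thesis by (simp add: divide_inverse_commute)
  qed
  then have "((\<lambda>y. norm (f y - f x - (y - x) *\<^sub>R f') / norm (y - x)) \<longlongrightarrow> 0) (at x)
      \<longleftrightarrow> ((\<lambda>y. norm ((f y - f x) /\<^sub>R (y - x) - f')) \<longlongrightarrow> 0) (at x)"
    by (intro filterlim_cong refl) (auto simp: eventually_at_filter)
  then show ?thesis
    by (simp add: has_vector_derivative_def has_derivative_iff_norm bounded_linear_scaleR_left
        tendsto_norm_zero_iff LIM_zero_iff)
qed

text \<open>As both curves vanish at \<open>x\<close>, their difference quotients are
  \<open>f y\<close> and \<open>g y\<close> divided by \<open>y - x\<close>, with equal norms near
  \<open>x\<close>. The two curves may live in different spaces, such as matrices and vectors of
  eigenvalues.\<close>

lemma norm_vector_derivative_eq: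
  fixes f :: "real \<Rightarrow> 'a::real_normed_vector" and g :: "real \<Rightarrow> 'b::real_normed_vector"
  assumes f: "(f has_vector_derivative f') (at x)" and g: "(g has_vector_derivative g') (at x)"
    and 0: "f x = 0" "g x = 0" and eq: "eventually (\<lambda>y. norm (f y) = norm (g y)) (at x)"
  shows "norm f' = norm g'"
proof -
  have f: "((\<lambda>y. norm (f y /\<^sub>R (y - x))) \<longlongrightarrow> norm f') (at x)"
    using f 0 by (intro tendsto_norm) (simp add: has_vector_derivative_iff_quotient)
  have g: "((\<lambda>y. norm (g y /\<^sub>R (y - x))) \<longlongrightarrow> norm g') (at x)"
    using g 0 by (intro tendsto_norm) (simp add: has_vector_derivative_iff_quotient)
  have "eventually (\<lambda>y. norm (f y /\<^sub>R (y - x)) = norm (g y /\<^sub>R (y - x))) (at x)"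
    using eq by eventually_elim simp
  from Lim_transform_eventually[OF f this] g show ?thesis
    using LIM_unique by blast
qed

lemma has_vector_derivative_componentwise:
  fixes f :: "real \<Rightarrow> 'a::real_normed_vector^'n"
  assumes "\<And>i. ((\<lambda>t. f t $ i) has_vector_derivative f' $ i) (at x)"
  shows "(f has_vector_derivative f') (at x)"
  using assms unfolding has_vector_derivative_iff_quotient by (intro vec_tendstoI) simp

section \<open>Eigenvalue derivatives along differentiable curves of matrices\<close>

lemma poly_vec_has_vector_derivative:
  fixes l :: "real \<Rightarrow> complex^'d"
  assumes "(l has_vector_derivative m) (at x)"
  shows "((\<lambda>t. poly_vec p (l t)) has_vector_derivative (\<chi> i. poly (pderiv p) (l x $ i) * m $ i)) (at x)"
proof (rule has_vector_derivative_componentwise)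
  fix i
  show "((\<lambda>t. poly_vec p (l t) $ i) has_vector_derivative (\<chi> i. poly (pderiv p) (l x $ i) * m $ i) $ i) (at x)"
    using field_vector_diff_chain_at[OF bounded_linear.has_vector_derivative[OF bounded_linear_vec_nth assms]
       poly_DERIV[of p "l x $ i"]]
    by (simp add: poly_vec_def o_def mult.commute)
qed

text \<open>Derivatives are taken at the single point \<open>x\<close>, but diagonalizability is
  required in a neighbourhood, since norms and traces at nearby points are compared.\<close>

locale diagonalizable_curve =
  fixes A :: "real \<Rightarrow> complex^'d^'d" and l :: "real \<Rightarrow> complex^'d" and B m x
  assumes diag: "eventually (\<lambda>y. unitarily_diag (A y) (l y)) (nhds x)"
    and A': "(A has_vector_derivative B) (at x)" and l': "(l has_vector_derivative m) (at x)"
begin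

lemma diag_at: "unitarily_diag (A x) (l x)"
  using diag eventually_nhds_x_imp_x by blast

text \<open>Both \<open>poly_mat p (A y)\<close> and \<open>poly_vec p (l y)\<close> vanish at
  \<open>y = x\<close> and have equal norms for \<open>y\<close> near \<open>x\<close>.\<close>

lemma norm_poly_derivative_eq:
  assumes p: "\<And>i. poly p (l x $ i) = 0"
  shows "norm (\<chi> i. poly (pderiv p) (l x $ i) * m $ i) = norm (dpoly_mat p (A x) B)"
proof (rule norm_vector_derivative_eq[OF poly_vec_has_vector_derivative[OF l'] poly_mat_has_vector_derivative[OF A']])
  show 0: "poly_vec p (l x) = 0"
    using p by (simp add: poly_vec_def vec_eq_iff)
  show "poly_mat p (A x) = 0"
    using norm_unitarily_diag[OF unitarily_diag_poly[OF diag_at, of p]] 0 by simp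
  have "\<forall>\<^sub>F y in nhds x. norm (poly_vec p (l y)) = norm (poly_mat p (A y))"
    using diag by eventually_elim (metis norm_unitarily_diag unitarily_diag_poly)
  then show "\<forall>\<^sub>F y in at x. norm (poly_vec p (l y)) = norm (poly_mat p (A y))"
    using eventually_nhds_conv_at by blast
qed

text \<open>Choose \<open>p\<close> with value 0 and derivative 1 at the eigenvalues of
  \<open>A x\<close>: the left side of \<open>norm_poly_derivative_eq\<close> becomes
  \<open>norm m\<close>, and \<open>norm_dpoly_mat_le\<close> bounds the right side by
  \<open>norm B\<close>.\<close>

lemma norm_derivative_le: "norm m \<le> norm B"
proof -
  obtain p where p: "\<And>i. poly p (l x $ i) = 0" "\<And>i. poly (pderiv p) (l x $ i) = 1"
    using Hermite_interpolation[of "range (\<lambda>i. l x $ i)" "\<lambda>_. 0" "\<lambda>_. 1"] by auto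
  from norm_dpoly_mat_le[OF diag_at p] norm_poly_derivative_eq[OF p(1)] p(2)
  show ?thesis by (metis (no_types, lifting) mult_1 vec_lambda_eta vec_lambda_unique)
qed

text \<open>Near \<open>x\<close> the trace of \<open>poly_mat p (A y)\<close> is the sum of the
  \<open>poly p (l y $ i)\<close>; both sides are differentiated. Unlike the norm identity, this
  holds for every \<open>p\<close>.\<close>

lemma trace_dpoly_mat:
  "trace (dpoly_mat p (A x) B) = (\<Sum>i\<in>UNIV. poly (pderiv p) (l x $ i) * m $ i)"
proof -
  have 1: "((\<lambda>t. \<Sum>i\<in>UNIV. poly_vec p (l t) $ i) has_vector_derivative
     (\<Sum>i\<in>UNIV. (\<chi> i. poly (pderiv p) (l x $ i) * m $ i) $ i)) (at x)"
    by (intro has_vector_derivative_sum bounded_linear.has_vector_derivative[OF bounded_linear_vec_nth]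
        poly_vec_has_vector_derivative[OF l'])
  have "\<forall>\<^sub>F y in nhds x. trace (poly_mat p (A y)) = (\<Sum>i\<in>UNIV. poly_vec p (l y) $ i)"
    using diag by eventually_elim (intro trace_unitarily_diag unitarily_diag_poly)
  with trace_has_vector_derivative[OF poly_mat_has_vector_derivative[OF A', of p]]
  have 2: "((\<lambda>t. \<Sum>i\<in>UNIV. poly_vec p (l t) $ i) has_vector_derivative trace (dpoly_mat p (A x) B)) (at x)"
    using has_vector_derivative_cong_ev[where S = UNIV and f = "\<lambda>y. trace (poly_mat p (A y))"
        and g = "\<lambda>y. \<Sum>i\<in>UNIV. poly_vec p (l y) $ i" and x = x] eventually_nhds_x_imp_x
    by (smt (verit) eventually_mono)
  from vector_derivative_unique_at[OF 1 2] show ?thesis by simp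
qed

end

text \<open>The polynomial image of the curve is again a diagonalizable curve. Arbitrary
  \<open>p\<close> is allowed here, so a polynomial fitted to a limit matrix can be used along the
  approximating sequence.\<close>

lemma (in diagonalizable_curve) norm_poly_derivative_le:
  "norm (\<chi> i. poly (pderiv p) (l x $ i) * m $ i) \<le> norm (dpoly_mat p (A x) B)"
proof -
  interpret p: diagonalizable_curve "\<lambda>t. poly_mat p (A t)" "\<lambda>t. poly_vec p (l t)"
    "dpoly_mat p (A x) B" "\<chi> i. poly (pderiv p) (l x $ i) * m $ i" x
  proof
    show "\<forall>\<^sub>F y in nhds x. unitarily_diag (poly_mat p (A y)) (poly_vec p (l y))"
      using diag by eventually_elim (rule unitarily_diag_poly)
  qed (intro poly_mat_has_vector_derivative A' poly_vec_has_vector_derivative l')+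
  show ?thesis by (rule p.norm_derivative_le)
qed

section \<open>Pointwise convergence of the norms of eigenvalue derivatives\<close>

lemma norm_mult_componentwise_le: "norm (\<chi> i. v $ i * w $ i) \<le> norm v * norm w"
  for v w :: "complex^'d"
proof -
  have "norm (\<chi> i. v $ i * w $ i) \<le> norm (norm v *\<^sub>R w)"
    by (intro norm_le_componentwise_cart)
      (simp add: norm_mult mult_right_mono Finite_Cartesian_Product.norm_nth_le)
  then show ?thesis by simp
qed

lemma norm_sum_mult_le: "cmod (\<Sum>i\<in>UNIV. v $ i * w $ i) \<le> norm v * norm w"
  for v w :: "complex^'d"
proof -
  have "cmod (\<Sum>i\<in>UNIV. v $ i * w $ i) \<le> (\<Sum>i\<in>UNIV. \<bar>cmod (v $ i)\<bar> * \<bar>cmod (w $ i)\<bar>)"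
    by (rule sum_norm_le) (simp add: norm_mult)
  also have "\<dots> \<le> norm v * norm w"
    unfolding norm_vec_def by (rule L2_set_mult_ineq)
  finally show ?thesis .
qed

text \<open>Two polynomials fitted to the spectrum of \<open>A x\<close> are applied to the whole
  sequence: \<open>p\<close> yields the upper bound, \<open>r\<close> through the trace the lower
  one. Only matrix quantities are passed to the limit, so the eigenvalues in \<open>ls n x\<close>
  may be ordered differently from those in \<open>l x\<close>.\<close>

lemma norm_eigenvalue_derivative_tendsto:
  fixes l :: "real \<Rightarrow> complex^'d" and m :: "complex^'d"
  assumes lim: "diagonalizable_curve A l B m x"
    and seq: "\<And>n. diagonalizable_curve (An n) (ls n) (Bn n) (mn n) x"
    and A: "(\<lambda>n. An n x) \<longlonglongrightarrow> A x" and B: "Bn \<longlonglongrightarrow> B"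
    and multiple: "\<And>i j. l x $ i = l x $ j \<Longrightarrow> m $ i = m $ j"
  shows "(\<lambda>n. norm (mn n)) \<longlonglongrightarrow> norm m"
proof -
  interpret lim: diagonalizable_curve A l B m x by fact
  note seq_diag = diagonalizable_curve.diag_at[OF seq]
  obtain p where p: "\<And>i. poly p (l x $ i) = 0" "\<And>i. poly (pderiv p) (l x $ i) = 1"
    using Hermite_interpolation[of "range (\<lambda>i. l x $ i)" "\<lambda>_. 0" "\<lambda>_. 1"] by auto
  define u where "u n = norm (dpoly_mat p (An n x) (Bn n))" for n
  \<comment> \<open>\<open>e n\<close> measures how far \<open>pderiv p\<close> is from 1 on the
    spectrum of \<open>An n x\<close>; it tends to 0 because the deviation vanishes on the spectrum
    of \<open>A x\<close>.\<close>
  define e where "e n = norm (poly_mat (pderiv p - 1) (An n x))" for n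
  have "u \<longlonglongrightarrow> norm (dpoly_mat p (A x) B)"
    unfolding u_def by (intro tendsto_norm tendsto_dpoly_mat A B)
  then have u: "u \<longlonglongrightarrow> norm m"
    using lim.norm_poly_derivative_eq[of p] p by simp
  have "e \<longlonglongrightarrow> norm (poly_mat (pderiv p - 1) (A x))"
    unfolding e_def by (intro tendsto_norm tendsto_poly_mat A)
  also have "norm (poly_mat (pderiv p - 1) (A x)) = norm (poly_vec (pderiv p - 1) (l x))"
    by (intro norm_unitarily_diag unitarily_diag_poly lim.diag_at)
  also have "poly_vec (pderiv p - 1) (l x) = 0"
    by (simp add: poly_vec_def vec_eq_iff p)
  finally have e: "e \<longlonglongrightarrow> 0" by simp
  have upper: "norm (mn n) \<le> u n + e n * norm (Bn n)" for n
  proof -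
    have "mn n = (\<chi> i. poly (pderiv p) (ls n x $ i) * mn n $ i)
        - (\<chi> i. poly_vec (pderiv p - 1) (ls n x) $ i * mn n $ i)"
      by (simp add: vec_eq_iff poly_vec_def algebra_simps)
    then have "norm (mn n) \<le> norm (\<chi> i. poly (pderiv p) (ls n x $ i) * mn n $ i)
        + norm (\<chi> i. poly_vec (pderiv p - 1) (ls n x) $ i * mn n $ i)"
      by (metis norm_triangle_ineq4)
    also have "\<dots> \<le> u n + norm (poly_vec (pderiv p - 1) (ls n x)) * norm (mn n)"
      unfolding u_def
      by (intro add_mono norm_mult_componentwise_le diagonalizable_curve.norm_poly_derivative_le[OF seq])
    also have "norm (poly_vec (pderiv p - 1) (ls n x)) = e n"
      unfolding e_def by (intro norm_unitarily_diag[symmetric] unitarily_diag_poly seq_diag)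
    \<comment> \<open>The crude bound of \<open>mn n\<close> by the convergent \<open>Bn n\<close>
      is good enough in a term with the factor \<open>e n\<close>.\<close>
    also have "u n + e n * norm (mn n) \<le> u n + e n * norm (Bn n)"
      using diagonalizable_curve.norm_derivative_le[OF seq] by (simp add: e_def mult_left_mono)
    finally show ?thesis .
  qed
  have upper_lim: "(\<lambda>n. u n + e n * norm (Bn n)) \<longlonglongrightarrow> norm m"
    using tendsto_add[OF u tendsto_mult[OF e tendsto_norm[OF B]]] by simp
  \<comment> \<open>By \<open>multiple\<close>, the conjugate of \<open>m $ i\<close> depends on the
    eigenvalue \<open>l x $ i\<close> alone and can therefore be interpolated. With
    \<open>pderiv r\<close> taking these values, the trace at the limit becomes
    \<open>hdot m m\<close>.\<close>
  define g where "g z = cnj (m $ (SOME i. l x $ i = z))" for z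
  have g: "g (l x $ i) = cnj (m $ i)" for i
    unfolding g_def using someI[of "\<lambda>j. l x $ j = l x $ i" i] multiple by metis
  obtain r where r: "\<And>i. poly (pderiv r) (l x $ i) = cnj (m $ i)"
    using Hermite_interpolation[of "range (\<lambda>i. l x $ i)" "\<lambda>_. 0" g] g by auto
  define t where "t n = cmod (trace (dpoly_mat r (An n x) (Bn n)))" for n
  define s where "s n = norm (poly_mat (pderiv r) (An n x))" for n
  have "t \<longlonglongrightarrow> cmod (trace (dpoly_mat r (A x) B))"
    unfolding t_def by (intro tendsto_norm tendsto_trace tendsto_dpoly_mat A B)
  also have "trace (dpoly_mat r (A x) B) = hdot m m"
    by (simp add: lim.trace_dpoly_mat r hdot_def)
  finally have t: "t \<longlonglongrightarrow> (norm m)\<^sup>2"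
    by (simp add: hdot_self norm_power)
  have "s \<longlonglongrightarrow> norm (poly_mat (pderiv r) (A x))"
    unfolding s_def by (intro tendsto_norm tendsto_poly_mat A)
  also have "norm (poly_mat (pderiv r) (A x)) = norm (poly_vec (pderiv r) (l x))"
    by (intro norm_unitarily_diag unitarily_diag_poly lim.diag_at)
  also have "\<dots> = norm m"
    by (simp add: poly_vec_def norm_vec_def r)
  finally have s: "s \<longlonglongrightarrow> norm m" .
  have lower: "t n / s n \<le> norm (mn n)" for n
  proof -
    have "t n = cmod (\<Sum>i\<in>UNIV. poly_vec (pderiv r) (ls n x) $ i * mn n $ i)"
      by (simp add: t_def diagonalizable_curve.trace_dpoly_mat[OF seq] poly_vec_def)
    also have "\<dots> \<le> norm (poly_vec (pderiv r) (ls n x)) * norm (mn n)"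
      by (rule norm_sum_mult_le)
    also have "norm (poly_vec (pderiv r) (ls n x)) = s n"
      unfolding s_def by (intro norm_unitarily_diag[symmetric] unitarily_diag_poly seq_diag)
    finally show ?thesis
      \<comment> \<open>Where \<open>s n = 0\<close>, the quotient is 0 by the convention for
        division.\<close>
      by (cases "s n = 0") (auto simp: s_def divide_le_eq mult.commute)
  qed
  show ?thesis
  \<comment> \<open>For \<open>m = 0\<close> the denominators \<open>s n\<close> tend to 0, and the
    trivial lower bound 0 replaces the quotient.\<close>
  proof (cases "m = 0")
    case True
    then show ?thesis
      using upper upper_lim
        tendsto_sandwich[of "\<lambda>_. 0" "\<lambda>n. norm (mn n)" _ "\<lambda>n. u n + e n * norm (Bn n)" 0]
      by auto
  next
    case False
    then have "(\<lambda>n. t n / s n) \<longlonglongrightarrow> norm m"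
      using tendsto_divide[OF t s] by (simp add: power2_eq_square)
    from tendsto_sandwich[OF _ _ this upper_lim] lower upper show ?thesis
      by simp
  qed
qed

section \<open>Lebesgue's differentiation theorem on the line\<close>

text \<open>Every exceptional point \<open>x\<close> is the endpoint of arbitrarily short intervals on which the Riemann
  sum with tag \<open>x\<close> is off by more than \<open>\<epsilon>\<close> times their length. Henstock's lemma makes the total length of
  disjoint such intervals small, and by Vitali their fivefold enlargements cover the exceptional set.\<close>

lemma indefinite_integral_derivative_exception_negligible:
  fixes g :: "real \<Rightarrow> 'n::euclidean_space"
  assumes g: "g integrable_on {a..b}" and "\<epsilon> > 0"
  shows "negligible {x\<in>{a..b}. \<forall>\<delta>>0. \<exists>y\<in>{a..b}. \<bar>y - x\<bar> < \<delta> \<and>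
    norm (integral {a..y} g - integral {a..x} g - (y - x) *\<^sub>R g x) > \<epsilon> * \<bar>y - x\<bar>}"
    (is "negligible ?E")
  unfolding negligible_outer_le
proof (intro allI impI)
  fix e :: real assume "e > 0"
  define E where "E = ?E"
  have Eab: "x \<in> {a..b}" if "x \<in> E" for x using that by (simp add: E_def)
  define F where "F x = integral {a..x} g" for x
  \<comment> \<open>The 5 is Vitali's enlargement factor: disjoint bad intervals of total length at
    most \<open>e / 5\<close> have enlargements of total length at most \<open>e\<close>.\<close>
  define \<eta> where "\<eta> = \<epsilon> * e / 5"
  have "\<eta> > 0" using \<open>e > 0\<close> \<open>\<epsilon> > 0\<close> by (simp add: \<eta>_def)
  have "g integrable_on cbox a b" using g by simp
  obtain \<gamma> where "gauge \<gamma>"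
    and \<gamma>: "\<And>p. \<lbrakk>p tagged_partial_division_of (cbox a b); \<gamma> fine p\<rbrakk> \<Longrightarrow>
             (\<Sum>(x,k)\<in>p. norm (measure lborel k *\<^sub>R g x - integral k g)) < \<eta>"
    by (rule Henstock_lemma[OF \<open>g integrable_on cbox a b\<close> \<open>\<eta> > 0\<close>]) (rule that)
  \<comment> \<open>Failure at arbitrarily small scales supplies a bad interval inside the gauge set
    of \<open>x\<close>, with the tag \<open>x\<close> as an endpoint.\<close>
  have "\<exists>y\<in>{a..b}. {min x y..max x y} \<subseteq> \<gamma> x \<and> norm (F y - F x - (y - x) *\<^sub>R g x) > \<epsilon> * \<bar>y - x\<bar>"
    if xE: "x \<in> E" for x
  proof -
    obtain \<delta> where \<delta>: "\<delta> > 0" "ball x \<delta> \<subseteq> \<gamma> x"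
      using \<open>gauge \<gamma>\<close> unfolding gauge_def by (meson openE)
    then obtain y where y: "y \<in> {a..b}" "\<bar>y - x\<bar> < \<delta>" "norm (F y - F x - (y - x) *\<^sub>R g x) > \<epsilon> * \<bar>y - x\<bar>"
      using xE unfolding F_def E_def by blast
    have "{min x y..max x y} \<subseteq> ball x \<delta>"
      using y(2) by (auto simp: dist_real_def)
    with y \<delta> show ?thesis by blast
  qed
  then obtain y where y: "\<And>x. x \<in> E \<Longrightarrow> y x \<in> {a..b}"
      "\<And>x. x \<in> E \<Longrightarrow> {min x (y x)..max x (y x)} \<subseteq> \<gamma> x"
      "\<And>x. x \<in> E \<Longrightarrow> norm (F (y x) - F x - (y x - x) *\<^sub>R g x) > \<epsilon> * \<bar>y x - x\<bar>"
    by metis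
  have ne: "y x \<noteq> x" if "x \<in> E" for x
    using y(3)[OF that] by auto
  \<comment> \<open>The covering lemma speaks of balls: centre and radius of the interval between
    \<open>x\<close> and \<open>y x\<close>, whichever of the two is larger.\<close>
  define c where "c x = (x + y x) / 2" for x
  define r where "r x = \<bar>y x - x\<bar> / 2" for x
  have cb: "cball (c x) (r x) = {min x (y x)..max x (y x)}" for x
    unfolding cball_eq_atLeastAtMost c_def r_def by (auto simp: min_def max_def field_simps)
  have r: "0 < r x \<and> r x \<le> b - a" if "x \<in> E" for x
    using y(1)[OF that] ne[OF that] Eab[OF that] by (auto simp: r_def)
  have cov: "E \<subseteq> (\<Union>x\<in>E. cball (c x) (r x))"
    unfolding cb by (auto simp: min_def)
  obtain C where C: "countable C" "C \<subseteq> E"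
      "pairwise (\<lambda>i j. disjnt (cball (c i) (r i)) (cball (c j) (r j))) C"
      "E \<subseteq> (\<Union>i\<in>C. cball (c i) (5 * r i))"
    by (rule Vitali_covering_lemma_cballs[OF cov r]) (assumption, rule that)
  have increment_le: "\<epsilon> * (2 * r x) \<le> norm (measure lborel (cball (c x) (r x)) *\<^sub>R g x - integral (cball (c x) (r x)) g)"
    if "x \<in> E" for x
  proof -
    have xy: "x \<in> {a..b}" "y x \<in> {a..b}" using Eab y(1) that by auto
    have split: "F v - F u = integral {u..v} g" if "u \<le> v" "u \<in> {a..b}" "v \<in> {a..b}" for u v
      using Henstock_Kurzweil_Integration.integral_combine[of a u v g] that integrable_on_subinterval[OF g, of a v]
      by (auto simp: F_def algebra_simps)
    have "norm (F (y x) - F x - (y x - x) *\<^sub>R g x)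
        = norm (measure lborel (cball (c x) (r x)) *\<^sub>R g x - integral (cball (c x) (r x)) g)"
    proof (cases "x \<le> y x")
      case True
      then show ?thesis
        using split[OF True xy] by (simp add: cb norm_minus_commute)
    next
      case False
      then have "F (y x) - F x - (y x - x) *\<^sub>R g x = (x - y x) *\<^sub>R g x - integral {y x..x} g"
        using split[of "y x" x] xy by (simp add: algebra_simps)
      with False show ?thesis by (simp add: cb)
    qed
    with y(3)[OF that] show ?thesis by (simp add: r_def)
  qed
  \<comment> \<open>Henstock's lemma concerns finite families; the bound does not depend on
    \<open>D\<close> and so passes to the countable union.\<close>
  have "measure lebesgue (\<Union>i\<in>D. cball (c i) (5 * r i)) \<le> e" if D: "D \<subseteq> C" "finite D" for D
  proof -
    define p where "p = (\<lambda>x. (x, cball (c x) (r x))) ` D"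
    have DE: "D \<subseteq> E" using D C by blast
    have inj: "inj_on (\<lambda>x. (x, cball (c x) (r x))) D" by (simp add: inj_on_def)
    have "p tagged_partial_division_of (cbox a b)"
      unfolding tagged_partial_division_of_def
    proof (intro conjI allI impI)
      show "finite p" using D by (simp add: p_def)
      fix x K assume "(x, K) \<in> p"
      then have x: "x \<in> D" "K = {min x (y x)..max x (y x)}" by (auto simp: p_def cb)
      then have "x \<in> E" using DE by blast
      then show "x \<in> K" "K \<subseteq> cbox a b" using x y(1)[of x] Eab[of x] by auto
      show "\<exists>a b. K = cbox a b" unfolding x(2) box_real(2)[symmetric] by blast
    next
      fix x K x' K' assume *: "(x, K) \<in> p \<and> (x', K') \<in> p \<and> (x, K) \<noteq> (x', K')"
      then have x: "x \<in> D" "K = cball (c x) (r x)" "x' \<in> D" "K' = cball (c x') (r x')"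
        by (auto simp: p_def)
      then have "disjnt K K'"
        using C(3) D * by (auto simp: pairwise_def)
      then show "interior K \<inter> interior K' = {}"
        using interior_subset unfolding disjnt_def by blast
    qed
    moreover have "\<gamma> fine p"
      unfolding fine_def p_def using DE y(2) by (auto simp: cb)
    ultimately have "(\<Sum>(x,k)\<in>p. norm (measure lborel k *\<^sub>R g x - integral k g)) < \<eta>"
      by (rule \<gamma>)
    then have "(\<Sum>x\<in>D. norm (measure lborel (cball (c x) (r x)) *\<^sub>R g x - integral (cball (c x) (r x)) g)) < \<eta>"
      unfolding p_def by (subst (asm) sum.reindex[OF inj]) (simp add: o_def)
    moreover have "(\<Sum>x\<in>D. \<epsilon> * (2 * r x)) \<le> (\<Sum>x\<in>D. norm (measure lborel (cball (c x) (r x)) *\<^sub>R g x - integral (cball (c x) (r x)) g))"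
      using DE by (intro sum_mono increment_le) auto
    ultimately have "\<epsilon> * (\<Sum>x\<in>D. 2 * r x) \<le> \<epsilon> * (e / 5)"
      by (simp add: sum_distrib_left \<eta>_def)
    then have sum_le: "(\<Sum>x\<in>D. 10 * r x) \<le> e"
      using \<open>\<epsilon> > 0\<close> by (simp add: sum_distrib_left[symmetric])
    have "measure lebesgue (\<Union>i\<in>D. cball (c i) (5 * r i)) \<le> (\<Sum>i\<in>D. measure lebesgue (cball (c i) (5 * r i)))"
      using D by (intro measure_UNION_le) auto
    also have "\<dots> = (\<Sum>i\<in>D. 10 * r i)"
      by (intro sum.cong refl) (auto simp: cball_eq_atLeastAtMost r_def)
    finally show ?thesis using sum_le by simp
  qed
  then have bound: "measure lebesgue (\<Union>i\<in>D. cball (c i) (5 * r i)) \<le> e" if "D \<subseteq> C" "finite D" for D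
    using that by blast
  have "(\<Union>i\<in>C. cball (c i) (5 * r i)) \<in> lmeasurable"
    by (rule fmeasurable_UN_bound[OF C(1) _ bound]) auto
  moreover have "measure lebesgue (\<Union>i\<in>C. cball (c i) (5 * r i)) \<le> e"
    by (rule measure_UN_bound[OF C(1) _ bound]) auto
  ultimately show "\<exists>T. ?E \<subseteq> T \<and> T \<in> lmeasurable \<and> measure lebesgue T \<le> e"
    using C(4) unfolding E_def by blast
qed

text \<open>The tolerances 1 / (n + 1) suffice to express differentiability, so the exceptional
  points lie in a countable union of null sets.\<close>

lemma indefinite_integral_has_vector_derivative_ae:
  fixes g :: "real \<Rightarrow> 'n::euclidean_space"
  assumes g: "g integrable_on {a..b}"
  obtains N where "negligible N"
    "\<And>x. x \<in> {a<..<b} - N \<Longrightarrow> ((\<lambda>t. integral {a..t} g) has_vector_derivative g x) (at x)"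
proof
  define E where "E \<epsilon> = {x\<in>{a..b}. \<forall>\<delta>>0. \<exists>y\<in>{a..b}. \<bar>y - x\<bar> < \<delta> \<and>
    norm (integral {a..y} g - integral {a..x} g - (y - x) *\<^sub>R g x) > \<epsilon> * \<bar>y - x\<bar>}" for \<epsilon>
  have "negligible (E \<epsilon>)" if "\<epsilon> > 0" for \<epsilon>
    unfolding E_def using g that by (rule indefinite_integral_derivative_exception_negligible)
  then show "negligible (\<Union>n. E (1 / Suc n))"
    by (intro negligible_countable_Union) auto
  fix x assume x: "x \<in> {a<..<b} - (\<Union>n. E (1 / Suc n))"
  show "((\<lambda>t. integral {a..t} g) has_vector_derivative g x) (at x)"
    unfolding has_vector_derivative_def has_derivative_at_alt
  proof (intro conjI bounded_linear_scaleR_left allI impI)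
    fix e :: real assume "e > 0"
    then obtain n where n: "1 / Suc n < e"
      using nat_approx_posE by blast
    from x have "x \<notin> E (1 / Suc n)" "x \<in> {a..b}" by auto
    then obtain \<delta> where \<delta>: "\<delta> > 0" "\<And>y. y \<in> {a..b} \<Longrightarrow> \<bar>y - x\<bar> < \<delta> \<Longrightarrow>
        norm (integral {a..y} g - integral {a..x} g - (y - x) *\<^sub>R g x) \<le> 1 / Suc n * \<bar>y - x\<bar>"
      unfolding E_def mem_Collect_eq not_less[symmetric] by blast
    show "\<exists>d>0. \<forall>y. norm (y - x) < d \<longrightarrow>
        norm (integral {a..y} g - integral {a..x} g - (y - x) *\<^sub>R g x) \<le> e * norm (y - x)"
    \<comment> \<open>The terms \<open>x - a\<close> and \<open>b - x\<close> keep \<open>y\<close>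
      inside the interval.\<close>
    proof (intro exI[of _ "Min {\<delta>, x - a, b - x}"] conjI allI impI)
      fix y assume "norm (y - x) < Min {\<delta>, x - a, b - x}"
      then have "norm (integral {a..y} g - integral {a..x} g - (y - x) *\<^sub>R g x) \<le> 1 / Suc n * \<bar>y - x\<bar>"
        by (intro \<delta>(2)) auto
      also have "\<dots> \<le> e * norm (y - x)"
        using mult_right_mono[OF less_imp_le[OF n], of "norm (y - x)"] by simp
      finally show "norm (integral {a..y} g - integral {a..x} g - (y - x) *\<^sub>R g x) \<le> e * norm (y - x)" .
    qed (use x \<delta> in auto)
  qed
qed

section \<open>Weak derivatives are derivatives almost everywhere\<close>

definition flat_exp :: "real poly \<Rightarrow> real \<Rightarrow> real" where
  "flat_exp P x = (if x > 0 then poly P (1 / x) * exp (- (1 / x)) else 0)"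

lemma tendsto_poly_mult_exp_minus: "((\<lambda>y. poly P y * exp (- y)) \<longlongrightarrow> 0) at_top" for P :: "real poly"
proof -
  have "((\<lambda>y. \<Sum>i\<le>degree P. coeff P i * (y ^ i / exp y)) \<longlongrightarrow> (\<Sum>i\<le>degree P. coeff P i * 0)) at_top"
    by (intro tendsto_sum tendsto_mult tendsto_const tendsto_power_div_exp_0)
  then show ?thesis
    by (simp add: poly_altdef sum_distrib_right exp_minus divide_inverse mult.assoc)
qed

text \<open>With y = 1/x, the derivative of P(y) exp(-y) in x is y^2 (P - P')(y) exp(-y). Carrying a
  polynomial along thus makes the class closed under differentiation; at 0 the exponential decay
  beats every polynomial.\<close>

lemma DERIV_flat_exp:
  "(flat_exp P has_real_derivative flat_exp ([:0, 0, 1:] * (P - pderiv P)) x) (at x)"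
proof (cases "x = 0" "x > 0" rule: bool.exhaust[case_product bool.exhaust])
  case True_True
  then show ?thesis by simp
next
  case True_False
  \<comment> \<open>The difference quotient at 0 has the extra factor 1/y, absorbed as
    \<open>pCons 0 P\<close>.\<close>
  have "((\<lambda>y. poly (pCons 0 P) (inverse y) * exp (- inverse y)) \<longlongrightarrow> 0) (at_right 0)"
    by (rule filterlim_compose[OF tendsto_poly_mult_exp_minus filterlim_inverse_at_top_right])
  then have "((\<lambda>y. flat_exp P y / y) \<longlongrightarrow> 0) (at_right 0)"
    by (rule Lim_transform_eventually)
      (auto simp: eventually_at_right_field flat_exp_def divide_inverse intro!: exI[of _ 1])
  moreover have "((\<lambda>y. flat_exp P y / y) \<longlongrightarrow> 0) (at_left 0)"
    by (rule Lim_transform_eventually[OF tendsto_const])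
      (auto simp: eventually_at_left_field flat_exp_def intro!: exI[of _ "-1"])
  ultimately have "((\<lambda>y. flat_exp P y / y) \<longlongrightarrow> 0) (at 0)"
    by (simp add: filterlim_at_split)
  with True_False show ?thesis
    by (simp add: has_field_derivative_iff) (simp add: flat_exp_def)
next
  case False_True
  have "((\<lambda>y. poly P (1 / y) * exp (- (1 / y))) has_real_derivative
      flat_exp ([:0, 0, 1:] * (P - pderiv P)) x) (at x)"
    using False_True
    by (auto intro!: derivative_eq_intros DERIV_chain'[where g = "poly P"] poly_DERIV
        simp: flat_exp_def field_simps power2_eq_square)
  then show ?thesis
    by (rule has_field_derivative_transform_within_open[of _ _ _ "{0<..}"])
      (use False_True in \<open>auto simp: flat_exp_def\<close>)
next
  case False_False
  have "((\<lambda>y. 0) has_real_derivative flat_exp ([:0, 0, 1:] * (P - pderiv P)) x) (at x)"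
    using False_False by (simp add: flat_exp_def)
  then show ?thesis
    by (rule has_field_derivative_transform_within_open[of _ _ _ "{..<0}"])
      (use False_False in \<open>auto simp: flat_exp_def\<close>)
qed

lemma flat_exp_smult: "flat_exp (smult c P) x = c * flat_exp P x"
  by (simp add: flat_exp_def)

inductive bump_sum :: "(real \<Rightarrow> real) \<Rightarrow> bool" where
  prod: "bump_sum (\<lambda>x. flat_exp P (\<alpha> * x + \<beta>) * flat_exp Q (\<gamma> * x + \<delta>))"
| add: "bump_sum f \<Longrightarrow> bump_sum g \<Longrightarrow> bump_sum (\<lambda>x. f x + g x)"

lemma bump_sum_derivative:
  assumes "bump_sum f"
  shows "\<exists>f'. bump_sum f' \<and> (\<forall>x. (f has_real_derivative f' x) (at x))"
  using assms
proof induction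
  case (prod P \<alpha> \<beta> Q \<gamma> \<delta>)
  let ?D = "\<lambda>P. [:0, 0, 1:] * (P - pderiv P)"
  let ?f' = "\<lambda>x. flat_exp (smult \<alpha> (?D P)) (\<alpha> * x + \<beta>) * flat_exp Q (\<gamma> * x + \<delta>)
    + flat_exp P (\<alpha> * x + \<beta>) * flat_exp (smult \<gamma> (?D Q)) (\<gamma> * x + \<delta>)"
  have "bump_sum ?f'"
    by (intro bump_sum.intros)
  moreover have "((\<lambda>x. flat_exp P (\<alpha> * x + \<beta>) * flat_exp Q (\<gamma> * x + \<delta>)) has_real_derivative ?f' x) (at x)" for x
    unfolding flat_exp_smult
    by (rule derivative_eq_intros DERIV_chain'[OF _ DERIV_flat_exp] refl)+ simp
  ultimately show ?case by blast
next
  case (add f g)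
  then obtain f' g' where "bump_sum f'" "bump_sum g'"
    "\<And>x. (f has_real_derivative f' x) (at x)" "\<And>x. (g has_real_derivative g' x) (at x)"
    by blast
  then show ?case
    by (intro exI[of _ "\<lambda>x. f' x + g' x"]) (auto intro: bump_sum.add DERIV_add)
qed

lemma bump_sum_funpow_deriv: "bump_sum f \<Longrightarrow> bump_sum ((deriv ^^ k) f)"
proof (induction k)
  case (Suc k)
  then obtain f' where f': "bump_sum f'" "\<And>x. ((deriv ^^ k) f has_real_derivative f' x) (at x)"
    using bump_sum_derivative by blast
  then have "deriv ((deriv ^^ k) f) = f'"
    by (intro ext DERIV_imp_deriv)
  with f' show ?case by simp
qed simp

text \<open>Meant for differences of smooth steps, which are known to the class only through their
  derivatives.\<close>

lemma bump_sum_antiderivative_smooth: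
  assumes "bump_sum f'" and f: "\<And>x. (f has_real_derivative f' x) (at x)"
  shows "(deriv ^^ k) f field_differentiable at x"
proof (cases k)
  case 0
  then show ?thesis using f by (auto simp: field_differentiable_def)
next
  case (Suc j)
  have "deriv f = f'"
    using f by (intro ext DERIV_imp_deriv)
  then have "(deriv ^^ k) f = (deriv ^^ j) f'"
    by (simp only: Suc funpow_Suc_right o_apply)
  then show ?thesis
    using bump_sum_derivative[OF bump_sum_funpow_deriv[OF assms(1), of j]]
    by (auto simp: field_differentiable_def)
qed

text \<open>\<open>\<sigma>\<close> is a bump on [-1, 1] divided by its integral \<open>c\<close>,
  and \<open>S\<close> is its antiderivative. The last property provides smoothness at all scales
  and centres.\<close>

lemma ex_smooth_step:
  obtains S \<sigma> :: "real \<Rightarrow> real" where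
    "\<And>x. (S has_real_derivative \<sigma> x) (at x)" "\<And>x. 0 \<le> \<sigma> x" "\<And>x. 1 \<le> \<bar>x\<bar> \<Longrightarrow> \<sigma> x = 0"
    "\<And>x. x \<le> -1 \<Longrightarrow> S x = 0" "\<And>x. x \<ge> 1 \<Longrightarrow> S x = 1"
    "\<And>k c s. bump_sum (\<lambda>x. c * \<sigma> (k * (x - s)))"
proof -
  \<comment> \<open>The first factor vanishes for x \<le> -1 and the second for x \<ge> 1; the
    coefficients are written out to match \<open>bump_sum.prod\<close>.\<close>
  define \<psi> where "\<psi> x = flat_exp 1 (1 * x + 1) * flat_exp 1 ((-1) * x + 1)" for x
  have "bump_sum \<psi>"
    unfolding \<psi>_def by (rule bump_sum.prod)
  then have "isCont \<psi> x" for x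
    using bump_sum_derivative DERIV_isCont by blast
  then obtain F where F: "\<And>x. (F has_real_derivative \<psi> x) (at x)"
    using einterval_antiderivative[of "-\<infinity>" "\<infinity>" \<psi>]
    by (auto simp: has_real_derivative_iff_has_vector_derivative)
  have nonneg: "0 \<le> \<psi> x" for x by (simp add: \<psi>_def flat_exp_def)
  have pos: "0 < \<psi> x" if "-1 < x" "x < 1" for x using that by (simp add: \<psi>_def flat_exp_def)
  have zero: "\<psi> x = 0" if "1 \<le> \<bar>x\<bar>" for x using that by (auto simp: \<psi>_def flat_exp_def)
  have contF: "continuous_on T F" for T
    using F by (meson DERIV_continuous_on has_field_derivative_at_within)
  have const: "F u = F v" if "u \<le> v" "v \<le> -1 \<or> 1 \<le> u" for u v
  proof (cases "u = v")
    case False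
    have "F v = F u"
    proof (rule DERIV_isconst_end[OF _ contF])
      fix x assume "u < x" "x < v"
      then have "\<psi> x = 0" using that by (intro zero) auto
      with F[of x] show "(F has_real_derivative 0) (at x)" by simp
    qed (use False that in simp)
    then show ?thesis ..
  qed simp
  define c where "c = F 1 - F (-1)"
  have "F (-1) < F 1"
    by (rule DERIV_pos_imp_increasing_open[OF _ _ contF]) (use F pos in auto)
  then have c: "c > 0" by (simp add: c_def)
  show thesis
  proof (rule that[of "\<lambda>x. (F x - F (-1)) / c" "\<lambda>x. \<psi> x / c"])
    show "((\<lambda>x. (F x - F (-1)) / c) has_real_derivative \<psi> x / c) (at x)" for x
      using c by (auto intro!: derivative_eq_intros F)
    show "(F x - F (-1)) / c = 0" if "x \<le> -1" for x
      using const[of x "-1"] that by simp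
    show "(F x - F (-1)) / c = 1" if "x \<ge> 1" for x
      using const[of 1 x] that c by (simp add: c_def)
    show "bump_sum (\<lambda>x. d * (\<psi> (k * (x - s)) / c))" for k d s
    proof -
      have "bump_sum (\<lambda>x. flat_exp (smult (d / c) 1) (k * x + (1 - k * s)) * flat_exp 1 ((-k) * x + (1 + k * s)))"
        by (rule bump_sum.prod)
      also have "(\<lambda>x. flat_exp (smult (d / c) 1) (k * x + (1 - k * s)) * flat_exp 1 ((-k) * x + (1 + k * s)))
          = (\<lambda>x. d * (\<psi> (k * (x - s)) / c))"
        unfolding \<psi>_def flat_exp_smult by (simp add: algebra_simps)
      finally show ?thesis .
    qed
  qed (use nonneg zero c in auto)
qed

section \<open>Mollification and the fundamental theorem for weak derivatives\<close>

lemma DERIV_scaled_shift: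
  fixes S :: "real \<Rightarrow> real"
  assumes "\<And>x. (S has_real_derivative \<sigma> x) (at x)"
  shows "((\<lambda>x. S (k * (x - s))) has_real_derivative k * \<sigma> (k * (x - s))) (at x)"
proof -
  have "((\<lambda>x. k * (x - s)) has_real_derivative k) (at x)"
    by (auto intro!: derivative_eq_intros)
  from DERIV_chain'[OF this assms] show ?thesis by (simp add: mult.commute)
qed

lemma LINT_superset:
  fixes h :: "'a::euclidean_space \<Rightarrow> 'b::euclidean_space"
  assumes "K \<in> sets lebesgue" "I \<in> sets lebesgue" "K \<subseteq> I" "\<And>x. x \<in> I - K \<Longrightarrow> h x = 0"
  shows "(LINT x|lebesgue_on I. h x) = (LINT x|lebesgue_on K. h x)"
proof -
  have "(LINT x|lebesgue_on I. h x) = (LINT x|lebesgue. indicator I x *\<^sub>R h x)"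
    using assms(2) by (intro integral_restrict_space) simp
  also have "\<dots> = (LINT x|lebesgue. indicator K x *\<^sub>R h x)"
    using assms(3,4) by (intro Bochner_Integration.integral_cong) (auto simp: indicator_def)
  also have "\<dots> = (LINT x|lebesgue_on K. h x)"
    using assms(1) by (intro integral_restrict_space[symmetric]) simp
  finally show ?thesis .
qed

text \<open>The kernels form an approximate identity at \<open>s\<close>: nonnegative, of mass 1 on
  \<open>{u..v}\<close> for large \<open>n\<close>, and zero at distance at least 1/n from
  \<open>s\<close>.\<close>

lemma mollifier_tendsto:
  fixes f :: "real \<Rightarrow> 'a::euclidean_space"
  assumes S: "\<And>x. (S has_real_derivative \<sigma> x) (at x)" and \<sigma>: "\<And>x. 0 \<le> \<sigma> x" "\<And>x. 1 \<le> \<bar>x\<bar> \<Longrightarrow> \<sigma> x = 0"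
    and S01: "\<And>x. x \<le> -1 \<Longrightarrow> S x = 0" "\<And>x. x \<ge> 1 \<Longrightarrow> S x = 1"
    and cont\<sigma>: "continuous_on UNIV \<sigma>"
    and f: "continuous_on {u..v} f" and s: "u < s" "s < v"
  shows "(\<lambda>n. integral {u..v} (\<lambda>x. (real n * \<sigma> (real n * (x - s))) *\<^sub>R f x)) \<longlonglongrightarrow> f s"
proof (rule LIMSEQ_I)
  fix e :: real assume "e > 0"
  then obtain d where d: "d > 0" "\<And>x. x \<in> {u..v} \<Longrightarrow> dist x s < d \<Longrightarrow> dist (f x) (f s) < e / 2"
    using f s unfolding continuous_on_iff by (metis atLeastAtMost_iff half_gt_zero less_imp_le)
  \<comment> \<open>Once \<open>n * m > 1\<close>, the kernel is supported inside
    \<open>{u..v}\<close>, which gives mass 1, and in the region where \<open>f\<close> is within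
    \<open>e / 2\<close> of \<open>f s\<close>.\<close>
  define m where "m = Min {d, s - u, v - s}"
  have "m > 0" using d s by (simp add: m_def)
  then obtain N where N: "inverse (real (Suc N)) < m" using reals_Archimedean by blast
  show "\<exists>N. \<forall>n\<ge>N. norm (integral {u..v} (\<lambda>x. (real n * \<sigma> (real n * (x - s))) *\<^sub>R f x) - f s) < e"
  proof (intro exI[of _ "Suc N"] allI impI)
    fix n assume n: "Suc N \<le> n"
    have "1 = inverse (real (Suc N)) * Suc N" by simp
    also have "\<dots> \<le> inverse (real (Suc N)) * n" using n by (intro mult_left_mono) auto
    also have "\<dots> < m * n" using N n by (intro mult_strict_right_mono) auto
    finally have nm: "1 < real n * m" by (simp add: mult.commute)
    have "n > 0" using n by simp
    define \<eta> where "\<eta> x = real n * \<sigma> (real n * (x - s))" for x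
    have cont\<eta>: "continuous_on {u..v} \<eta>"
      unfolding \<eta>_def by (intro continuous_intros continuous_on_compose2[OF cont\<sigma>]) auto
    have "((\<lambda>x. S (real n * (x - s))) has_real_derivative \<eta> x) (at x)" for x
      unfolding \<eta>_def by (rule DERIV_scaled_shift[OF S])
    then have "(\<eta> has_integral S (real n * (v - s)) - S (real n * (u - s))) {u..v}"
      using s by (intro fundamental_theorem_of_calculus)
        (auto simp: has_real_derivative_iff_has_vector_derivative[symmetric] intro: has_field_derivative_at_within)
    moreover have "S (real n * (v - s)) = 1" "S (real n * (u - s)) = 0"
    proof -
      have "real n * m \<le> real n * (v - s)" "real n * m \<le> real n * (s - u)"
        by (auto intro!: mult_left_mono simp: m_def)
      with nm show "S (real n * (v - s)) = 1" "S (real n * (u - s)) = 0"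
        by (auto intro!: S01 simp: algebra_simps)
    qed
    ultimately have int\<eta>: "(\<eta> has_integral 1) {u..v}" by simp
    have "integral {u..v} (\<lambda>x. \<eta> x *\<^sub>R f x) - f s = integral {u..v} (\<lambda>x. \<eta> x *\<^sub>R (f x - f s))"
    proof -
      have "(\<lambda>x. \<eta> x *\<^sub>R f x) integrable_on {u..v}"
        by (intro integrable_continuous_interval continuous_intros cont\<eta> f)
      from has_integral_diff[OF integrable_integral[OF this] has_integral_scaleR_left[OF int\<eta>, of "f s"]]
      show ?thesis by (simp add: scaleR_diff_right integral_unique)
    qed
    also have "norm \<dots> \<le> integral {u..v} (\<lambda>x. e / 2 * \<eta> x)"
    proof (rule Henstock_Kurzweil_Integration.integral_norm_bound_integral)
      show "(\<lambda>x. \<eta> x *\<^sub>R (f x - f s)) integrable_on {u..v}" "(\<lambda>x. e / 2 * \<eta> x) integrable_on {u..v}"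
        by (intro integrable_continuous_interval continuous_intros cont\<eta> f)+
      fix x assume x: "x \<in> {u..v}"
      show "norm (\<eta> x *\<^sub>R (f x - f s)) \<le> e / 2 * \<eta> x"
      proof (cases "\<bar>x - s\<bar> < d")
        case True
        then have "norm (f x - f s) \<le> e / 2"
          using d(2)[OF x] by (simp add: dist_norm)
        moreover have "0 \<le> \<eta> x" using \<sigma> by (simp add: \<eta>_def)
        ultimately show ?thesis
          using mult_left_mono[of "norm (f x - f s)" "e / 2" "\<eta> x"] by (simp add: mult.commute)
      next
        case False
        then have "real n * m \<le> real n * \<bar>x - s\<bar>"
          by (intro mult_left_mono) (auto simp: m_def)
        with nm have "1 \<le> \<bar>real n * (x - s)\<bar>" by (simp add: abs_mult)
        then have "\<eta> x = 0" using \<sigma> by (simp add: \<eta>_def)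
        then show ?thesis by simp
      qed
    qed
    also have "\<dots> = e / 2"
      using int\<eta> by (simp add: integral_unique)
    also have "\<dots> < e" using \<open>e > 0\<close> by simp
    finally show "norm (integral {u..v} (\<lambda>x. (real n * \<sigma> (real n * (x - s))) *\<^sub>R f x) - f s) < e"
      by (simp add: \<eta>_def)
  qed
qed

text \<open>For a smooth step \<open>S\<close> from 0 to 1, the test functions \<open>S (n (x - s)) - S (n (x - t))\<close> tend to the
  indicator of \<open>[s, t]\<close>, and their derivatives to the difference of the point masses at \<open>s\<close> and \<open>t\<close>.\<close>

lemma has_weak_deriv_imp_integral:
  fixes f g :: "real \<Rightarrow> 'a::euclidean_space"
  assumes f: "continuous_on {a<..<b} f" and weak: "has_weak_deriv {a<..<b} f g"
    and st: "a < s" "s < t" "t < b"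
  shows "g integrable_on {s..t}" "f t - f s = integral {s..t} g"
proof -
  have g: "integrable (lebesgue_on {u..v}) g" if "a < u" "v < b" for u v
  proof -
    have "compact {u..v}" "{u..v} \<subseteq> {a<..<b}" using that by auto
    then show ?thesis using weak unfolding has_weak_deriv_def locally_integrable_def by blast
  qed
  show "g integrable_on {s..t}"
    using g st by (intro integrable_on_lebesgue_on) auto
  obtain S \<sigma> :: "real \<Rightarrow> real" where
    S: "\<And>x. (S has_real_derivative \<sigma> x) (at x)" and \<sigma>: "\<And>x. 0 \<le> \<sigma> x" "\<And>x. 1 \<le> \<bar>x\<bar> \<Longrightarrow> \<sigma> x = 0"
    and S01: "\<And>x. x \<le> -1 \<Longrightarrow> S x = 0" "\<And>x. x \<ge> 1 \<Longrightarrow> S x = 1"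
    and bump: "\<And>k c s. bump_sum (\<lambda>x. c * \<sigma> (k * (x - s)))"
    by (rule ex_smooth_step) (rule that)
  have contS: "continuous_on UNIV S"
    using S by (meson DERIV_continuous_on has_field_derivative_at_within)
  have "bump_sum \<sigma>"
    using bump[of 1 1 0] by simp
  then have cont\<sigma>: "continuous_on UNIV \<sigma>"
    using bump_sum_derivative[of \<sigma>] by (meson DERIV_continuous_on has_field_derivative_at_within)
  have mono: "S x \<le> S y" if "x \<le> y" for x y
    using that by (rule DERIV_nonneg_imp_nondecreasing) (use S \<sigma> in blast)
  have bounds: "0 \<le> S x" "S x \<le> 1" for x
    using mono[of "min x (-1)" x] mono[of x "max x 1"] S01 by auto
  \<comment> \<open>Half of the smaller gap: \<open>{u..v}\<close> is then a compact part of
    \<open>{a<..<b}\<close>, on which \<open>g\<close> is integrable, with room for the supports of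
    the test functions.\<close>
  define d where "d = min (s - a) (b - t) / 2"
  have d: "d > 0" "a < s - d" "t + d < b"
    using st by (auto simp: d_def min_def field_simps)
  define u where "u = s - d"
  define v where "v = t + d"
  have uv: "a < u" "u < s" "t < v" "v < b" using d by (auto simp: u_def v_def)
  have fuv: "continuous_on {u..v} f"
    using f by (rule continuous_on_subset) (use uv in auto)
  define \<phi> where "\<phi> n x = S (real n * (x - s)) - S (real n * (x - t))" for n x
  define \<phi>' where "\<phi>' n x = real n * \<sigma> (real n * (x - s)) - real n * \<sigma> (real n * (x - t))" for n x
  have \<phi>': "(\<phi> n has_real_derivative \<phi>' n x) (at x)" for n x
    unfolding \<phi>_def \<phi>'_def by (intro DERIV_diff DERIV_scaled_shift S)
  have deriv\<phi>: "deriv (\<phi> n) = \<phi>' n" for n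
    using \<phi>' by (intro ext DERIV_imp_deriv)
  have cont\<phi>: "continuous_on X (\<phi> n)" and cont\<phi>': "continuous_on X (\<phi>' n)" for X n
    unfolding \<phi>_def \<phi>'_def
    by (intro continuous_intros continuous_on_compose2[OF contS] continuous_on_compose2[OF cont\<sigma>]; simp)+
  have "bump_sum (\<phi>' n)" for n
    using bump_sum.add[OF bump[of "real n" "real n" s] bump[of "- real n" "real n" t]]
    by (simp add: \<phi>'_def[abs_def])
  then have smooth: "(deriv ^^ k) (\<phi> n) field_differentiable at x" for n k x
    using \<phi>' by (rule bump_sum_antiderivative_smooth)
  obtain N where N: "inverse (real (Suc N)) < d" using reals_Archimedean d by blast
  have outside: "\<phi> n x = 0" "\<phi>' n x = 0" if n: "Suc N \<le> n" and x: "x \<notin> {u..v}" for n x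
  proof -
    have "1 = inverse (real (Suc N)) * Suc N" by simp
    also have "\<dots> \<le> d * n" using n N d by (intro mult_mono) auto
    finally have nd: "1 \<le> real n * d" by (simp add: mult.commute)
    show "\<phi> n x = 0"
    proof (cases "x < u")
      case True
      then have "real n * d \<le> real n * (s - x)" "real n * d \<le> real n * (t - x)"
        using st by (auto intro!: mult_left_mono simp: u_def)
      with nd show ?thesis by (simp add: \<phi>_def S01 algebra_simps)
    next
      case False
      then have "real n * d \<le> real n * (x - s)" "real n * d \<le> real n * (x - t)"
        using st x by (auto intro!: mult_left_mono simp: v_def)
      with nd show ?thesis by (simp add: \<phi>_def S01)
    qed
    have "real n * d \<le> real n * \<bar>x - s\<bar>" "real n * d \<le> real n * \<bar>x - t\<bar>"
      using x st by (auto intro!: mult_left_mono simp: u_def v_def)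
    with nd have "1 \<le> \<bar>real n * (x - s)\<bar>" "1 \<le> \<bar>real n * (x - t)\<bar>"
      by (simp_all add: abs_mult)
    then show "\<phi>' n x = 0" using \<sigma>(2) by (simp add: \<phi>'_def)
  qed
  have ev: "integral {u..v} (\<lambda>x. (real n * \<sigma> (real n * (x - s))) *\<^sub>R f x)
      - integral {u..v} (\<lambda>x. (real n * \<sigma> (real n * (x - t))) *\<^sub>R f x)
      = - (LINT x|lebesgue_on {u..v}. \<phi> n x *\<^sub>R g x)" if n: "Suc N \<le> n" for n
  proof -
    have "\<phi> n \<in> test_functions {a<..<b}"
      unfolding test_functions_def using smooth outside(1)[OF n] uv
      by (auto intro!: exI[of _ "{u..v}"])
    then have "(LINT x|lebesgue_on {a<..<b}. \<phi>' n x *\<^sub>R f x) = - (LINT x|lebesgue_on {a<..<b}. \<phi> n x *\<^sub>R g x)"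
      using weak unfolding has_weak_deriv_def deriv\<phi>[symmetric] by blast
    moreover have "(LINT x|lebesgue_on {a<..<b}. \<phi> n x *\<^sub>R g x) = (LINT x|lebesgue_on {u..v}. \<phi> n x *\<^sub>R g x)"
      using uv outside(1)[OF n] by (intro LINT_superset) auto
    moreover have "(LINT x|lebesgue_on {a<..<b}. \<phi>' n x *\<^sub>R f x) = (LINT x|lebesgue_on {u..v}. \<phi>' n x *\<^sub>R f x)"
      using uv outside(2)[OF n] by (intro LINT_superset) auto
    moreover have "(LINT x|lebesgue_on {u..v}. \<phi>' n x *\<^sub>R f x) = integral {u..v} (\<lambda>x. \<phi>' n x *\<^sub>R f x)"
      by (intro lebesgue_integral_eq_integral continuous_imp_integrable_real continuous_intros cont\<phi>' fuv) auto
    moreover have "integral {u..v} (\<lambda>x. \<phi>' n x *\<^sub>R f x)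
      = integral {u..v} (\<lambda>x. (real n * \<sigma> (real n * (x - s))) *\<^sub>R f x)
      - integral {u..v} (\<lambda>x. (real n * \<sigma> (real n * (x - t))) *\<^sub>R f x)"
      unfolding \<phi>'_def scaleR_diff_left
      by (intro Henstock_Kurzweil_Integration.integral_diff integrable_continuous_interval
          continuous_intros continuous_on_compose2[OF cont\<sigma>] fuv) auto
    ultimately show ?thesis by simp
  qed
  have "(\<lambda>n. integral {u..v} (\<lambda>x. (real n * \<sigma> (real n * (x - s))) *\<^sub>R f x)
      - integral {u..v} (\<lambda>x. (real n * \<sigma> (real n * (x - t))) *\<^sub>R f x)) \<longlonglongrightarrow> f s - f t"
    using uv st by (intro tendsto_diff mollifier_tendsto[OF S \<sigma> S01 cont\<sigma> fuv]) auto
  then have lim1: "(\<lambda>n. - (LINT x|lebesgue_on {u..v}. \<phi> n x *\<^sub>R g x)) \<longlonglongrightarrow> f s - f t"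
    by (rule Lim_transform_eventually) (rule eventually_mono[OF eventually_ge_at_top[of "Suc N"] ev])
  \<comment> \<open>The norm of \<open>g\<close> dominates because \<open>S\<close> takes values in
    [0, 1]. At \<open>s\<close> and \<open>t\<close> the limit of \<open>\<phi> n\<close> depends on
    \<open>S 0\<close>, but these two points form a null set.\<close>
  have lim2: "(\<lambda>n. LINT x|lebesgue_on {u..v}. \<phi> n x *\<^sub>R g x)
      \<longlonglongrightarrow> (LINT x|lebesgue_on {u..v}. indicator {s..t} x *\<^sub>R g x)"
  proof (rule integral_dominated_convergence[where w = "\<lambda>x. norm (g x)"])
    note guv = g[OF uv(1) uv(4)]
    have [measurable]: "g \<in> borel_measurable (lebesgue_on {u..v})" using guv by auto
    have [measurable]: "\<phi> n \<in> borel_measurable (lebesgue_on {u..v})" for n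
      by (intro continuous_imp_measurable_on_sets_lebesgue cont\<phi>) auto
    show "(\<lambda>x. \<phi> n x *\<^sub>R g x) \<in> borel_measurable (lebesgue_on {u..v})" for n by measurable
    have "indicat_real {s..t} \<in> borel_measurable (lebesgue_on {u..v})"
      by (intro measurable_restrict_space1 borel_measurable_indicator) simp
    then show "(\<lambda>x. indicat_real {s..t} x *\<^sub>R g x) \<in> borel_measurable (lebesgue_on {u..v})"
      by measurable
    show "integrable (lebesgue_on {u..v}) (\<lambda>x. norm (g x))" using guv by simp
    have "\<bar>\<phi> n x\<bar> \<le> 1" for n x
      using bounds[of "real n * (x - s)"] bounds[of "real n * (x - t)"] by (simp add: \<phi>_def)
    then have "norm (\<phi> n x *\<^sub>R g x) \<le> norm (g x)" for n x
      by (simp add: mult_left_le_one_le)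
    then show "AE x in lebesgue_on {u..v}. norm (\<phi> n x *\<^sub>R g x) \<le> norm (g x)" for n by simp
    have S_lim: "(\<lambda>n. S (real n * y)) \<longlonglongrightarrow> (if y > 0 then 1 else 0)" if "y \<noteq> 0" for y
    proof -
      obtain M where M: "real M * \<bar>y\<bar> > 1" using reals_Archimedean3[of "\<bar>y\<bar>"] \<open>y \<noteq> 0\<close> by (metis zero_less_abs_iff)
      have "S (real n * y) = (if y > 0 then 1 else 0)" if "n \<ge> M" for n
      proof -
        have "real M * \<bar>y\<bar> \<le> real n * \<bar>y\<bar>" using that by (intro mult_right_mono) auto
        with M have "1 \<le> real n * \<bar>y\<bar>" by linarith
        then show ?thesis using \<open>y \<noteq> 0\<close> by (cases "y > 0") (simp_all add: S01)
      qed
      then show ?thesis by (intro tendsto_eventually eventually_sequentiallyI[of M])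
    qed
    have "(\<lambda>n. \<phi> n x *\<^sub>R g x) \<longlonglongrightarrow> indicator {s..t} x *\<^sub>R g x" if "x \<notin> {s, t}" for x
    proof -
      have "(\<lambda>n. \<phi> n x) \<longlonglongrightarrow> (if x - s > 0 then 1 else 0) - (if x - t > 0 then 1 else 0)"
        unfolding \<phi>_def using that by (intro tendsto_diff S_lim) auto
      also have "(if x - s > 0 then 1 else 0) - (if x - t > 0 then 1 else 0) = (indicator {s..t} x :: real)"
        using that st by (auto simp: indicator_def)
      finally show ?thesis by (intro tendsto_intros)
    qed
    moreover have "{s, t} \<in> null_sets (lebesgue_on {u..v})"
      using uv st negligible_finite[of "{s, t}"]
      by (subst null_sets_restrict_space) (auto simp: negligible_iff_null_sets)
    ultimately show "AE x in lebesgue_on {u..v}. (\<lambda>n. \<phi> n x *\<^sub>R g x) \<longlonglongrightarrow> indicator {s..t} x *\<^sub>R g x"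
      by (intro AE_I'[of "{s, t}"]) auto
  qed
  have "(LINT x|lebesgue_on {u..v}. indicator {s..t} x *\<^sub>R g x) = (LINT x|lebesgue_on {s..t}. indicator {s..t} x *\<^sub>R g x)"
    using uv st by (intro LINT_superset) auto
  also have "\<dots> = (LINT x|lebesgue_on {s..t}. g x)"
    by (intro Bochner_Integration.integral_cong) auto
  also have "\<dots> = integral {s..t} g"
    using g st by (intro lebesgue_integral_eq_integral) auto
  finally have "f s - f t = - integral {s..t} g"
    using LIMSEQ_unique[OF lim1 tendsto_minus[OF lim2]] by simp
  then show "f t - f s = integral {s..t} g" by (metis minus_diff_eq minus_minus)
qed

text \<open>As \<open>g\<close> is only locally integrable, the interval is exhausted by compact
  ones; on each of them \<open>f\<close> is a constant plus an indefinite integral of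
  \<open>g\<close>.\<close>

lemma has_weak_deriv_imp_vector_derivative_ae:
  fixes f g :: "real \<Rightarrow> 'a::euclidean_space"
  assumes f: "continuous_on {a<..<b} f" and weak: "has_weak_deriv {a<..<b} f g"
  obtains N where "negligible N" "\<And>x. x \<in> {a<..<b} - N \<Longrightarrow> (f has_vector_derivative g x) (at x)"
proof -
  define u where "u n = a + inverse (real (Suc n))" for n
  define v where "v n = b - inverse (real (Suc n))" for n
  have uv: "a < u n" "v n < b" for n by (simp_all add: u_def v_def)
  have "\<exists>N. negligible N \<and> (\<forall>x\<in>{u n<..<v n} - N. (f has_vector_derivative g x) (at x))" for n
  proof (cases "u n < v n")
    case True
    obtain N where N: "negligible N" "\<And>x. x \<in> {u n<..<v n} - N \<Longrightarrow>
        ((\<lambda>t. integral {u n..t} g) has_vector_derivative g x) (at x)"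
      using indefinite_integral_has_vector_derivative_ae has_weak_deriv_imp_integral(1)[OF f weak uv(1) True uv(2)]
      by blast
    have "(f has_vector_derivative g x) (at x)" if x: "x \<in> {u n<..<v n} - N" for x
    proof (rule has_vector_derivative_transform_within_open)
      show "((\<lambda>t. f (u n) + integral {u n..t} g) has_vector_derivative g x) (at x)"
        using has_vector_derivative_add[OF has_vector_derivative_const N(2)[OF x], of "f (u n)"] by simp
      show "f (u n) + integral {u n..y} g = f y" if "y \<in> {u n<..<v n}" for y
        using has_weak_deriv_imp_integral(2)[OF f weak uv(1), of n y] uv(2)[of n] that
        by (simp add: algebra_simps)
    qed (use x in auto)
    with N(1) show ?thesis by blast
  qed (auto intro!: exI[of _ "{}"])
  then obtain N where N: "\<And>n. negligible (N n)"
    "\<And>n x. x \<in> {u n<..<v n} - N n \<Longrightarrow> (f has_vector_derivative g x) (at x)"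
    by metis
  show thesis
  proof (rule that[of "\<Union>n. N n"])
    show "negligible (\<Union>n. N n)"
      using N(1) by (intro negligible_countable_Union) auto
    fix x assume x: "x \<in> {a<..<b} - (\<Union>n. N n)"
    then obtain n where "inverse (real (Suc n)) < min (x - a) (b - x)"
      using reals_Archimedean[of "min (x - a) (b - x)"] by auto
    with x show "(f has_vector_derivative g x) (at x)"
      by (intro N(2)[of x n]) (auto simp: u_def v_def)
  qed
qed

section \<open>Convergence of the eigenvalue derivatives\<close>

text \<open>The subsequence principle, needed because convergence of integrals gives convergence
  almost everywhere only along a subsequence.\<close>

lemma LIMSEQ_subseq_subseq:
  fixes L :: "'a::metric_space"
  assumes "\<And>r :: nat \<Rightarrow> nat. strict_mono r \<Longrightarrow> \<exists>s. strict_mono s \<and> (\<lambda>k. u (r (s k))) \<longlonglongrightarrow> L"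
  shows "u \<longlonglongrightarrow> L"
proof (rule ccontr)
  assume "\<not> u \<longlonglongrightarrow> L"
  then obtain e where e: "e > 0" "\<not> (\<forall>\<^sub>F n in sequentially. dist (u n) L < e)"
    unfolding tendsto_iff by blast
  then have "infinite {n. \<not> dist (u n) L < e}"
    by (simp add: cofinite_eq_sequentially[symmetric] eventually_cofinite)
  then obtain r :: "nat \<Rightarrow> nat" where r: "strict_mono r" "\<And>n. \<not> dist (u (r n)) L < e"
    using infinite_enumerate by blast
  obtain s where "(\<lambda>k. u (r (s k))) \<longlonglongrightarrow> L"
    using assms[OF r(1)] by blast
  then have "\<forall>\<^sub>F k in sequentially. dist (u (r (s k))) L < e"
    using e(1) by (rule tendstoD)
  with r(2) show False by simp
qed

text \<open>Dominated convergence with majorants that vary with \<open>n\<close>: \<open>u n\<close>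
  is at most \<open>min (u n) G + w n\<close>, where the minimum has the fixed majorant
  \<open>G\<close> and the integrals of \<open>w n\<close> tend to 0.\<close>

lemma integral_tendsto_0_dominated:
  fixes u w :: "nat \<Rightarrow> 'a \<Rightarrow> real"
  assumes u [measurable]: "\<And>n. u n \<in> borel_measurable M" and "integrable M G" "\<And>n. integrable M (w n)"
    and bound: "\<And>n. AE x in M. 0 \<le> u n x \<and> u n x \<le> G x + w n x"
    and G0: "AE x in M. 0 \<le> G x" and w0: "\<And>n. AE x in M. 0 \<le> w n x"
    and w: "(\<lambda>n. LINT x|M. w n x) \<longlonglongrightarrow> 0"
    and lim: "AE x in M. (\<lambda>n. u n x) \<longlonglongrightarrow> 0"
  shows "(\<lambda>n. LINT x|M. u n x) \<longlonglongrightarrow> 0"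
proof -
  have [measurable]: "G \<in> borel_measurable M" "w n \<in> borel_measurable M" for n
    using assms by auto
  have int: "integrable M (u n)" for n
  proof (rule Bochner_Integration.integrable_bound[of M "\<lambda>x. G x + w n x"])
    show "AE x in M. norm (u n x) \<le> norm (G x + w n x)"
      using bound[of n] by eventually_elim simp
  qed (use assms in auto)
  have min_int: "integrable M (\<lambda>x. min (u n x) (G x))" for n
    using int assms(2) by (intro integrable_min)
  have "(\<lambda>n. LINT x|M. min (u n x) (G x)) \<longlonglongrightarrow> (LINT x|M. 0)"
  proof (rule integral_dominated_convergence[where w = G])
    show "AE x in M. (\<lambda>n. min (u n x) (G x)) \<longlonglongrightarrow> 0"
      using lim G0
    proof eventually_elim
      case (elim x)
      have "(\<lambda>n. min (u n x) (G x)) \<longlonglongrightarrow> min 0 (G x)"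
        by (intro tendsto_min elim tendsto_const)
      with elim show ?case by simp
    qed
    show "AE x in M. norm (min (u n x) (G x)) \<le> G x" for n
      using bound[of n] G0 by eventually_elim auto
  qed (use assms(2) in auto)
  then have "(\<lambda>n. (LINT x|M. min (u n x) (G x)) + (LINT x|M. w n x)) \<longlonglongrightarrow> 0"
    using tendsto_add[OF _ w] by fastforce
  moreover have "(LINT x|M. u n x) \<le> (LINT x|M. min (u n x) (G x)) + (LINT x|M. w n x)" for n
  proof -
    have "(LINT x|M. u n x) \<le> (LINT x|M. min (u n x) (G x) + w n x)"
    proof (rule integral_mono_AE)
      show "AE x in M. u n x \<le> min (u n x) (G x) + w n x"
        using bound[of n] w0[of n] by eventually_elim auto
    qed (use int min_int assms(3) in auto)
    then show ?thesis using min_int assms(3) by simp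
  qed
  moreover have "0 \<le> (LINT x|M. u n x)" for n
    using bound[of n] by (intro integral_nonneg_AE) (auto elim: eventually_mono)
  ultimately show "(\<lambda>n. LINT x|M. u n x) \<longlonglongrightarrow> 0"
    using tendsto_sandwich[of "\<lambda>_. 0" "\<lambda>n. LINT x|M. u n x" sequentially
      "\<lambda>n. (LINT x|M. min (u n x) (G x)) + (LINT x|M. w n x)" 0] by simp
qed

text \<open>Such a zero is isolated, so rational endpoints can be chosen around it that enclose no
  other zero; this pair of rationals determines the zero.\<close>

lemma countable_zeros_nonzero_derivative:
  fixes h :: "real \<Rightarrow> 'a::real_normed_vector"
  shows "countable {x. h x = 0 \<and> (\<exists>h'. h' \<noteq> 0 \<and> (h has_vector_derivative h') (at x))}"
proof -
  define X where "X = {x. h x = 0 \<and> (\<exists>h'. h' \<noteq> 0 \<and> (h has_vector_derivative h') (at x))}"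
  have "\<exists>p\<in>\<rat> \<times> \<rat>. fst p < x \<and> x < snd p \<and> (\<forall>y. fst p < y \<and> y < snd p \<and> h y = 0 \<longrightarrow> y = x)"
    if xX: "x \<in> X" for x
  proof -
    obtain h' where h: "h x = 0" "h' \<noteq> 0" "(h has_vector_derivative h') (at x)"
      using xX unfolding X_def by blast
    then have "((\<lambda>y. h y /\<^sub>R (y - x)) \<longlongrightarrow> h') (at x)"
      by (simp add: has_vector_derivative_iff_quotient)
    then have "\<forall>\<^sub>F y in at x. h y /\<^sub>R (y - x) \<noteq> 0"
      using h(2) by (rule tendsto_imp_eventually_ne)
    then obtain d where d: "d > 0" "\<And>y. y \<noteq> x \<Longrightarrow> dist y x < d \<Longrightarrow> h y /\<^sub>R (y - x) \<noteq> 0"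
      unfolding eventually_at by blast
    obtain u where u: "u \<in> \<rat>" "x - d < u" "u < x"
      using Rats_dense_in_real[of "x - d" x] d by auto
    obtain v where v: "v \<in> \<rat>" "x < v" "v < x + d"
      using Rats_dense_in_real[of x "x + d"] d by auto
    have uniq: "y = x" if "u < y" "y < v" "h y = 0" for y
    proof -
      have "dist y x < d" using that u v by (auto simp: dist_real_def)
      with d(2)[of y] that(3) show ?thesis by auto
    qed
    show ?thesis
    proof (intro bexI[of _ "(u, v)"] conjI allI impI)
      fix y assume "fst (u, v) < y \<and> y < snd (u, v) \<and> h y = 0"
      then show "y = x" by (intro uniq) auto
    qed (use u v in auto)
  qed
  then obtain p where p: "\<And>x. x \<in> X \<Longrightarrow> p x \<in> \<rat> \<times> \<rat>" "\<And>x. x \<in> X \<Longrightarrow> fst (p x) < x \<and> x < snd (p x)"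
    "\<And>x y. x \<in> X \<Longrightarrow> fst (p x) < y \<Longrightarrow> y < snd (p x) \<Longrightarrow> h y = 0 \<Longrightarrow> y = x"
    by metis
  have "inj_on p X"
  proof (rule inj_onI)
    fix x y assume "x \<in> X" "y \<in> X" "p x = p y"
    moreover from this have "h x = 0" by (simp add: X_def)
    ultimately show "x = y" using p(2)[of x] p(3)[of y x] by simp
  qed
  moreover have "countable (p ` X)"
  proof (rule countable_subset)
    show "p ` X \<subseteq> \<rat> \<times> \<rat>" using p(1) by blast
  qed (intro countable_SIGMA countable_rat)
  ultimately show ?thesis
    unfolding X_def[symmetric] using countable_image_inj_on by blast
qed

section \<open>Functions in \<open>W1q\<close> and versions of their derivatives\<close>

lemma abs_continuous_on_imp_continuous_on:
  fixes f :: "real \<Rightarrow> 'a::euclidean_space"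
  assumes "abs_continuous_on I f" and I: "is_interval I"
  shows "continuous_on I f"
  unfolding continuous_on_iff
proof (intro ballI allI impI)
  fix x :: real and e :: real assume "x \<in> I" "e > 0"
  obtain \<delta> where "\<delta> > 0" and \<delta>: "\<And>P. finite P \<Longrightarrow> (\<forall>(s, t)\<in>P. s < t \<and> {s..t} \<subseteq> I) \<Longrightarrow>
      pairwise (\<lambda>(s, t) (s', t'). {s<..<t} \<inter> {s'<..<t'} = {}) P \<Longrightarrow>
      (\<Sum>(s, t)\<in>P. t - s) < \<delta> \<Longrightarrow> (\<Sum>(s, t)\<in>P. norm (f t - f s)) < e"
    using assms(1) \<open>e > 0\<close> unfolding abs_continuous_on_def by meson
  have *: "norm (f t - f s) < e" if "s < t" "s \<in> I" "t \<in> I" "t - s < \<delta>" for s t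
  proof -
    have "{s..t} \<subseteq> I"
      using I that(2,3) by (meson atLeastAtMost_iff mem_is_interval_1_I subsetI)
    then show ?thesis using \<delta>[of "{(s, t)}"] that by simp
  qed
  have "dist (f y) (f x) < e" if "y \<in> I" "dist y x < \<delta>" for y
    using *[of x y] *[of y x] that \<open>x \<in> I\<close> \<open>e > 0\<close>
    by (cases x y rule: linorder_cases) (auto simp: dist_norm norm_minus_commute)
  with \<open>\<delta> > 0\<close> show "\<exists>d>0. \<forall>y\<in>I. dist y x < d \<longrightarrow> dist (f y) (f x) < e" by blast
qed

lemma AE_lebesgue_onI:
  assumes "negligible N" "S \<in> sets lebesgue" "\<And>x. x \<in> S - N \<Longrightarrow> P x"
  shows "AE x in lebesgue_on S. P x"
proof -
  have "AE x in lebesgue. x \<in> S \<longrightarrow> P x"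
    using assms by (intro AE_I'[of N]) (auto simp: negligible_iff_null_sets)
  then show ?thesis using assms(2) by (simp add: AE_restrict_space_iff)
qed

text \<open>Completeness of Lebesgue measure. It transfers measurability to the arbitrarily chosen
  version \<open>weak_deriv\<close> from a version known to lie in \<open>Lq_fun\<close>.\<close>

lemma borel_measurable_lebesgue_on_AE:
  fixes f g :: "'a::euclidean_space \<Rightarrow> 'b::euclidean_space"
  assumes f: "f \<in> borel_measurable (lebesgue_on S)" and S: "S \<in> sets lebesgue"
    and ae: "AE x in lebesgue_on S. f x = g x"
  shows "g \<in> borel_measurable (lebesgue_on S)"
proof -
  have "AE x in lebesgue. (if x \<in> S then f x else 0) = (if x \<in> S then g x else 0)"
    using ae S by (auto simp: AE_restrict_space_iff elim!: eventually_mono)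
  moreover have "(\<lambda>x. if x \<in> S then f x else 0) \<in> borel_measurable lebesgue"
    using f S by (simp add: borel_measurable_if)
  ultimately have "(\<lambda>x. if x \<in> S then g x else 0) \<in> borel_measurable lebesgue"
    by (rule borel_measurable_AE[rotated])
  then show ?thesis using S by (simp add: borel_measurable_if)
qed

lemma Lq_fun_cong_AE:
  fixes f g :: "real \<Rightarrow> 'b::euclidean_space"
  assumes f: "Lq_fun q S f" and S: "S \<in> sets lebesgue" and ae: "AE x in lebesgue_on S. f x = g x"
  shows "Lq_fun q S g" "Lq_norm q S g = Lq_norm q S f"
proof -
  have f': "f \<in> borel_measurable (lebesgue_on S)" "integrable (lebesgue_on S) (\<lambda>x. norm (f x) powr q)"
    using f by (auto simp: Lq_fun_def)
  have g: "g \<in> borel_measurable (lebesgue_on S)"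
    using borel_measurable_lebesgue_on_AE[OF f'(1) S ae] .
  have eq: "AE x in lebesgue_on S. norm (f x) powr q = norm (g x) powr q"
    using ae by eventually_elim simp
  note [measurable] = f'(1) g
  show "Lq_fun q S g"
    unfolding Lq_fun_def using g integrable_cong_AE_imp[OF f'(2) _ eq] by simp
  have "(LINT x|lebesgue_on S. norm (g x) powr q) = (LINT x|lebesgue_on S. norm (f x) powr q)"
    using eq by (intro integral_cong_AE) (auto elim: eventually_mono)
  then show "Lq_norm q S g = Lq_norm q S f"
    by (simp add: Lq_norm_def)
qed

lemma powr_add_le:
  fixes x y q :: real
  assumes "0 \<le> x" "0 \<le> y" "0 \<le> q"
  shows "(x + y) powr q \<le> 2 powr q * x powr q + 2 powr q * y powr q"
proof -
  have "(x + y) powr q \<le> (2 * max x y) powr q"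
    using assms by (intro powr_mono2) auto
  also have "\<dots> = 2 powr q * max x y powr q"
    using assms by (simp add: powr_mult)
  also have "\<dots> \<le> 2 powr q * (x powr q + y powr q)"
    by (intro mult_left_mono) (auto simp: max_def)
  finally show ?thesis by (simp add: distrib_left)
qed

lemma Lq_fun_diff:
  fixes f g :: "real \<Rightarrow> 'b::euclidean_space"
  assumes f: "Lq_fun q S f" and g: "Lq_fun q S g" and q: "0 \<le> q"
  shows "Lq_fun q S (\<lambda>x. f x - g x)"
proof -
  have [measurable]: "f \<in> borel_measurable (lebesgue_on S)" "g \<in> borel_measurable (lebesgue_on S)"
    and int: "integrable (lebesgue_on S) (\<lambda>x. norm (f x) powr q)" "integrable (lebesgue_on S) (\<lambda>x. norm (g x) powr q)"
    using f g by (auto simp: Lq_fun_def)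
  have "integrable (lebesgue_on S) (\<lambda>x. norm (f x - g x) powr q)"
  proof (rule Bochner_Integration.integrable_bound)
    show "integrable (lebesgue_on S) (\<lambda>x. 2 powr q * norm (f x) powr q + 2 powr q * norm (g x) powr q)"
      using int by simp
    have "norm (f x - g x) powr q \<le> 2 powr q * norm (f x) powr q + 2 powr q * norm (g x) powr q" for x
      using powr_mono2[OF q norm_ge_zero norm_triangle_ineq4[of "f x" "g x"]]
        powr_add_le[of "norm (f x)" "norm (g x)" q] q by simp
    then show "AE x in lebesgue_on S. norm (norm (f x - g x) powr q)
        \<le> norm (2 powr q * norm (f x) powr q + 2 powr q * norm (g x) powr q)"
      by (intro AE_I2) (simp add: abs_of_nonneg)
  qed simp
  then show ?thesis by (simp add: Lq_fun_def)
qed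

lemma test_function_deriv_outside:
  assumes "compact K" "\<And>x. x \<notin> K \<Longrightarrow> \<phi> x = 0" "x \<notin> K"
  shows "deriv \<phi> x = (0::real)"
proof (rule DERIV_imp_deriv)
  show "(\<phi> has_real_derivative 0) (at x)"
    by (rule has_field_derivative_transform_within_open[of "\<lambda>_. 0" _ _ "- K"])
      (use assms in \<open>auto simp: compact_imp_closed open_Compl\<close>)
qed

text \<open>On \<open>K\<close> the continuous factor is bounded and \<open>f\<close> is integrable;
  off \<open>K\<close> the product vanishes. The additivity of the integrals in
  \<open>has_weak_deriv\<close> rests on this.\<close>

lemma test_function_integrable:
  fixes f :: "real \<Rightarrow> 'a::euclidean_space"
  assumes \<psi>: "continuous_on UNIV \<psi>" and K: "compact K" "K \<subseteq> I" "\<And>x. x \<notin> K \<Longrightarrow> \<psi> x = (0::real)"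
    and f: "locally_integrable I f" and I: "I \<in> sets lebesgue"
  shows "integrable (lebesgue_on I) (\<lambda>x. \<psi> x *\<^sub>R f x)"
proof -
  have fK: "integrable (lebesgue_on K) f"
    using f K by (simp add: locally_integrable_def)
  have KL: "K \<in> sets lebesgue"
    using K(1) by (simp add: compact_imp_closed)
  have [measurable]: "\<psi> \<in> borel_measurable (lebesgue_on K)" "f \<in> borel_measurable (lebesgue_on K)"
    using continuous_imp_measurable_on_sets_lebesgue[OF continuous_on_subset[OF \<psi>] KL] fK by auto
  obtain B where B: "\<And>x. x \<in> K \<Longrightarrow> norm (\<psi> x) \<le> B"
    using compact_imp_bounded[OF compact_continuous_image[OF continuous_on_subset[OF \<psi>] K(1)]]
    unfolding bounded_iff by blast
  have "integrable (lebesgue_on K) (\<lambda>x. \<psi> x *\<^sub>R f x)"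
  proof (rule Bochner_Integration.integrable_bound[of _ "\<lambda>x. B *\<^sub>R f x"])
    have "norm (\<psi> x *\<^sub>R f x) \<le> norm (B *\<^sub>R f x)" if "x \<in> K" for x
      using B[OF that] by (auto intro!: mult_right_mono)
    then show "AE x in lebesgue_on K. norm (\<psi> x *\<^sub>R f x) \<le> norm (B *\<^sub>R f x)"
      by (intro AE_I2) simp
  qed (use fK in auto)
  moreover have "(\<lambda>x. indicator I x *\<^sub>R (\<psi> x *\<^sub>R f x)) = (\<lambda>x. indicator K x *\<^sub>R (\<psi> x *\<^sub>R f x))"
    using K by (intro ext) (auto simp: indicator_def)
  ultimately show ?thesis
    using I KL integrable_restrict_space[of I lebesgue "\<lambda>x. \<psi> x *\<^sub>R f x"]
      integrable_restrict_space[of K lebesgue "\<lambda>x. \<psi> x *\<^sub>R f x"] by simp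
qed

lemma has_weak_deriv_diff:
  assumes f: "has_weak_deriv I f1 g1" "has_weak_deriv I f2 g2" and I: "I \<in> sets lebesgue"
  shows "has_weak_deriv I (\<lambda>x. f1 x - f2 x :: 'a::euclidean_space) (\<lambda>x. g1 x - g2 x)"
proof -
  have li: "locally_integrable I f1" "locally_integrable I g1" "locally_integrable I f2" "locally_integrable I g2"
    using f by (auto simp: has_weak_deriv_def)
  have "(LINT x|lebesgue_on I. deriv \<phi> x *\<^sub>R (f1 x - f2 x)) = - (LINT x|lebesgue_on I. \<phi> x *\<^sub>R (g1 x - g2 x))"
    if \<phi>: "\<phi> \<in> test_functions I" for \<phi>
  proof -
    obtain K where K: "compact K" "K \<subseteq> I" "\<And>x. x \<notin> K \<Longrightarrow> \<phi> x = 0"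
      and smooth: "\<And>k x. (deriv ^^ k) \<phi> field_differentiable at x"
      using \<phi> unfolding test_functions_def by blast
    have cont: "continuous_on UNIV ((deriv ^^ k) \<phi>)" for k
      by (intro continuous_at_imp_continuous_on ballI field_differentiable_imp_continuous_at smooth)
    have c: "continuous_on UNIV \<phi>" "continuous_on UNIV (deriv \<phi>)"
      using cont[of 0] cont[of 1] by auto
    have int1: "integrable (lebesgue_on I) (\<lambda>x. \<phi> x *\<^sub>R h x)"
      and int2: "integrable (lebesgue_on I) (\<lambda>x. deriv \<phi> x *\<^sub>R h x)"
      if "locally_integrable I h" for h :: "real \<Rightarrow> 'a"
      using test_function_integrable[OF c(1) K(1,2) _ that I] test_function_integrable[OF c(2) K(1,2) _ that I]
        K(3) test_function_deriv_outside[OF K(1)] by blast+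
    have eq: "(LINT x|lebesgue_on I. deriv \<phi> x *\<^sub>R f1 x) = - (LINT x|lebesgue_on I. \<phi> x *\<^sub>R g1 x)"
      "(LINT x|lebesgue_on I. deriv \<phi> x *\<^sub>R f2 x) = - (LINT x|lebesgue_on I. \<phi> x *\<^sub>R g2 x)"
      using f \<phi> unfolding has_weak_deriv_def by blast+
    show ?thesis
      unfolding scaleR_diff_right
        Bochner_Integration.integral_diff[OF int1[OF li(2)] int1[OF li(4)]]
        Bochner_Integration.integral_diff[OF int2[OF li(1)] int2[OF li(3)]]
      by (simp add: eq)
  qed
  then show ?thesis
    using li by (auto simp: has_weak_deriv_def locally_integrable_def)
qed

lemma has_weak_deriv_weak_deriv: "has_weak_deriv I f g \<Longrightarrow> has_weak_deriv I f (weak_deriv I f)"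
  unfolding weak_deriv_def by (rule someI[of "has_weak_deriv I f"])

lemma W1q_imp_continuous_on: "f \<in> W1q q {a<..<b} S \<Longrightarrow> continuous_on {a<..<b} f"
  by (auto simp: W1q_def intro: abs_continuous_on_imp_continuous_on)

lemma W1q_has_weak_deriv: "f \<in> W1q q I S \<Longrightarrow> has_weak_deriv I f (weak_deriv I f)"
  using has_weak_deriv_weak_deriv by (auto simp: W1q_def)

lemma has_weak_deriv_AE:
  fixes f :: "real \<Rightarrow> 'a::euclidean_space"
  assumes "continuous_on {a<..<b} f" "has_weak_deriv {a<..<b} f g"
  shows "AE x in lebesgue_on {a<..<b}. (f has_vector_derivative g x) (at x)"
proof -
  obtain N where "negligible N" "\<And>x. x \<in> {a<..<b} - N \<Longrightarrow> (f has_vector_derivative g x) (at x)"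
    using has_weak_deriv_imp_vector_derivative_ae[OF assms] by blast
  then show ?thesis by (intro AE_lebesgue_onI) auto
qed

lemma has_weak_deriv_unique_AE:
  fixes f :: "real \<Rightarrow> 'a::euclidean_space"
  assumes "continuous_on {a<..<b} f" "has_weak_deriv {a<..<b} f g" "has_weak_deriv {a<..<b} f h"
  shows "AE x in lebesgue_on {a<..<b}. g x = h x"
  using has_weak_deriv_AE[OF assms(1,2)] has_weak_deriv_AE[OF assms(1,3)]
  by eventually_elim (rule vector_derivative_unique_at)

text \<open>Membership in \<open>W1q\<close> grants only some version in \<open>Lq_fun\<close>; the
  chosen one agrees with it almost everywhere, since both are the classical derivative
  there.\<close>

lemma W1q_Lq_fun_weak_deriv:
  assumes f: "f \<in> W1q q {a<..<b} S"
  shows "Lq_fun q {a<..<b} (weak_deriv {a<..<b} f)"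
proof -
  obtain g where g: "has_weak_deriv {a<..<b} f g" "Lq_fun q {a<..<b} g"
    using f by (auto simp: W1q_def)
  show ?thesis
    by (rule Lq_fun_cong_AE(1)[OF g(2)])
      (use has_weak_deriv_unique_AE[OF W1q_imp_continuous_on[OF f] g(1) W1q_has_weak_deriv[OF f]] in auto)
qed

section \<open>Eigenvalue parameterizations in \<open>W1q\<close>\<close>

lemma W1q_diagonalizable_curve:
  fixes lam :: "real \<Rightarrow> complex^'d"
  assumes A: "A \<in> W1q q {a<..<b} normal_matrices" and lam: "lam \<in> W1q q {a<..<b} UNIV"
    and param: "eigenvalue_parameterization {a<..<b} A lam"
  shows "AE x in lebesgue_on {a<..<b}.
    diagonalizable_curve A lam (weak_deriv {a<..<b} A x) (weak_deriv {a<..<b} lam x) x"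
proof -
  have diag: "unitarily_diag (A x) (lam x)" if "x \<in> {a<..<b}" for x
    using A param that
    by (intro unitarily_diag_eigenvalues) (auto simp: W1q_def eigenvalue_parameterization_def)
  have "AE x in lebesgue_on {a<..<b}. x \<in> {a<..<b}"
    by (intro AE_I2) simp
  then show ?thesis
    using has_weak_deriv_AE[OF W1q_imp_continuous_on[OF A] W1q_has_weak_deriv[OF A]]
      has_weak_deriv_AE[OF W1q_imp_continuous_on[OF lam] W1q_has_weak_deriv[OF lam]]
  proof eventually_elim
    case (elim x)
    have "\<forall>\<^sub>F y in nhds x. y \<in> {a<..<b}"
      using elim(1) by (intro eventually_nhds_in_open) auto
    then have "\<forall>\<^sub>F y in nhds x. unitarily_diag (A y) (lam y)"
      by (rule eventually_mono) (rule diag)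
    with elim(2,3) show ?case by (simp add: diagonalizable_curve_def)
  qed
qed

text \<open>The difference of two components has a nonzero derivative at only countably many of its
  zeros, and there are finitely many pairs of components.\<close>

lemma W1q_multiple_components:
  fixes lam :: "real \<Rightarrow> complex^'d"
  assumes lam: "lam \<in> W1q q {a<..<b} UNIV"
  shows "AE x in lebesgue_on {a<..<b}. \<forall>i j. lam x $ i = lam x $ j \<longrightarrow>
    weak_deriv {a<..<b} lam x $ i = weak_deriv {a<..<b} lam x $ j"
proof -
  define X where "X i j = {x. lam x $ i - lam x $ j = 0 \<and>
    (\<exists>h'. h' \<noteq> 0 \<and> ((\<lambda>x. lam x $ i - lam x $ j) has_vector_derivative h') (at x))}" for i j
  have "countable (\<Union>i. \<Union>j. X i j)"
    unfolding X_def by (intro countable_UN countable_zeros_nonzero_derivative countableI_type)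
  then have "negligible (\<Union>i. \<Union>j. X i j)"
    by (simp add: negligible_iff_null_sets countable_imp_null_set_lborel null_sets_completionI)
  then have "AE x in lebesgue_on {a<..<b}. x \<notin> (\<Union>i. \<Union>j. X i j)"
    by (rule AE_lebesgue_onI) auto
  then show ?thesis
    using has_weak_deriv_AE[OF W1q_imp_continuous_on[OF lam] W1q_has_weak_deriv[OF lam]]
  proof eventually_elim
    case (elim x)
    have der: "((\<lambda>x. lam x $ i - lam x $ j) has_vector_derivative
        (weak_deriv {a<..<b} lam x $ i - weak_deriv {a<..<b} lam x $ j)) (at x)" for i j
      by (intro has_vector_derivative_diff bounded_linear.has_vector_derivative[OF bounded_linear_vec_nth] elim(2))
    show ?case
    proof (intro allI impI)
      fix i j assume eq: "lam x $ i = lam x $ j"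
      show "weak_deriv {a<..<b} lam x $ i = weak_deriv {a<..<b} lam x $ j"
      proof (rule ccontr)
        assume "weak_deriv {a<..<b} lam x $ i \<noteq> weak_deriv {a<..<b} lam x $ j"
        then have "x \<in> X i j"
          unfolding X_def mem_Collect_eq
          by (intro conjI exI[of _ "weak_deriv {a<..<b} lam x $ i - weak_deriv {a<..<b} lam x $ j"] der)
            (simp_all add: eq)
        with elim(1) show False by blast
      qed
    qed
  qed
qed

section \<open>Integrals of powers, domination and the limit\<close>

lemma Lq_norm_powr:
  assumes "0 < q"
  shows "Lq_norm q I f powr q = (LINT x|lebesgue_on I. norm (f x) powr q)"
  using assms by (simp add: Lq_norm_def powr_powr)

lemma Lq_norm_nonneg [simp]: "0 \<le> Lq_norm q I f"
  by (simp add: Lq_norm_def)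

lemma Lq_norm_tendsto_0D:
  assumes "0 < q" "(\<lambda>n. Lq_norm q I (f n)) \<longlonglongrightarrow> 0"
  shows "(\<lambda>n. LINT x|lebesgue_on I. norm (f n x) powr q) \<longlonglongrightarrow> 0"
  unfolding Lq_norm_powr[OF assms(1), symmetric]
  using assms by (intro tendsto_zero_powrI[OF assms(2) tendsto_const]) auto

theorem corollary1p10:
  fixes q a b :: real
    and I :: "real set"
    and A :: "real \<Rightarrow> complex^'d^'d"
    and An :: "nat \<Rightarrow> real \<Rightarrow> complex^'d^'d"
    and lam :: "real \<Rightarrow> complex^'d"
    and lam_n :: "nat \<Rightarrow> real \<Rightarrow> complex^'d"
  assumes "1 \<le> q"
    and "a < b" and "I = {a<..<b}"
    and "A \<in> W1q q I normal_matrices"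
    and "\<And>n. An n \<in> W1q q I normal_matrices"
    and "(\<lambda>n. W1q_norm q I (\<lambda>x. An n x - A x)) \<longlonglongrightarrow> 0"
    and "lam \<in> W1q q I UNIV"
    and "\<And>n. lam_n n \<in> W1q q I UNIV"
    and "eigenvalue_parameterization I A lam"
    and "\<And>n. eigenvalue_parameterization I (An n) (lam_n n)"
  shows "((\<lambda>n. Lq_norm q I (\<lambda>x. norm (weak_deriv I lam x) - norm (weak_deriv I (lam_n n) x)))
            \<longlonglongrightarrow> 0) \<and>
         ((\<lambda>n. Lq_norm q I (weak_deriv I (lam_n n))) \<longlonglongrightarrow> Lq_norm q I (weak_deriv I lam))"
proof -
  note I = \<open>I = {a<..<b}\<close> and W = assms(4,5,7,8)[unfolded \<open>I = {a<..<b}\<close>]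
  have q: "0 < q" "0 \<le> q" using \<open>1 \<le> q\<close> by auto
  have IL: "I \<in> sets lebesgue" by (simp add: I)
  define A' where "A' = weak_deriv I A"
  define An' where "An' n = weak_deriv I (An n)" for n
  define l' where "l' = weak_deriv I lam"
  define ln' where "ln' n = weak_deriv I (lam_n n)" for n
  have Lq: "Lq_fun q I A'" "Lq_fun q I (An' n)" "Lq_fun q I l'" "Lq_fun q I (ln' n)"
    "Lq_fun q I A" "Lq_fun q I (An n)" for n
    using W1q_Lq_fun_weak_deriv[OF W(1)] W1q_Lq_fun_weak_deriv[OF W(2)]
      W1q_Lq_fun_weak_deriv[OF W(3)] W1q_Lq_fun_weak_deriv[OF W(4)] assms(4,5)
    by (auto simp: A'_def An'_def l'_def ln'_def I W1q_def)
  then have [measurable]: "A' \<in> borel_measurable (lebesgue_on I)" "An' n \<in> borel_measurable (lebesgue_on I)"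
    "l' \<in> borel_measurable (lebesgue_on I)" "ln' n \<in> borel_measurable (lebesgue_on I)" for n
    by (auto simp: Lq_fun_def)
  have diff_int: "integrable (lebesgue_on I) (\<lambda>x. norm (An n x - A x) powr q)"
    "integrable (lebesgue_on I) (\<lambda>x. norm (An' n x - A' x) powr q)" for n
    using Lq_fun_diff[OF Lq(6) Lq(5) q(2)] Lq_fun_diff[OF Lq(2) Lq(1) q(2)] by (auto simp: Lq_fun_def)
  \<comment> \<open>The version chosen for the derivative of \<open>An n - A\<close> is unrelated to
    those chosen for \<open>An n\<close> and \<open>A\<close>, but agrees almost everywhere with
    their difference.\<close>
  have norm_diff: "Lq_norm q I (weak_deriv I (\<lambda>x. An n x - A x)) = Lq_norm q I (\<lambda>x. An' n x - A' x)" for n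
  proof (rule Lq_fun_cong_AE(2)[OF Lq_fun_diff[OF Lq(2) Lq(1) q(2)] IL])
    have "has_weak_deriv I (\<lambda>x. An n x - A x) (\<lambda>x. An' n x - A' x)"
      unfolding An'_def A'_def
      using assms(4,5) by (intro has_weak_deriv_diff W1q_has_weak_deriv IL)
    moreover have "continuous_on I (\<lambda>x. An n x - A x)"
      unfolding I by (intro continuous_on_diff W1q_imp_continuous_on[OF W(1)] W1q_imp_continuous_on[OF W(2)])
    ultimately show "AE x in lebesgue_on I. An' n x - A' x = weak_deriv I (\<lambda>x. An n x - A x) x"
      unfolding I using has_weak_deriv_unique_AE has_weak_deriv_weak_deriv by blast
  qed
  have W1q_norm_eq: "W1q_norm q I (\<lambda>x. An n x - A x) = Lq_norm q I (\<lambda>x. An n x - A x) + Lq_norm q I (\<lambda>x. An' n x - A' x)" for n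
    by (simp add: W1q_norm_def norm_diff)
  have "(\<lambda>n. Lq_norm q I (\<lambda>x. An n x - A x)) \<longlonglongrightarrow> 0"
    by (rule tendsto_sandwich[OF _ _ tendsto_const assms(6)]) (auto simp: W1q_norm_eq)
  then have lim0: "(\<lambda>n. LINT x|lebesgue_on I. norm (An n x - A x) powr q) \<longlonglongrightarrow> 0"
    by (rule Lq_norm_tendsto_0D[OF q(1)])
  have "(\<lambda>n. Lq_norm q I (\<lambda>x. An' n x - A' x)) \<longlonglongrightarrow> 0"
    by (rule tendsto_sandwich[OF _ _ tendsto_const assms(6)]) (auto simp: W1q_norm_eq)
  then have lim1: "(\<lambda>n. LINT x|lebesgue_on I. norm (An' n x - A' x) powr q) \<longlonglongrightarrow> 0"
    by (rule Lq_norm_tendsto_0D[OF q(1)])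
  have curve: "AE x in lebesgue_on I. diagonalizable_curve A lam (A' x) (l' x) x"
    using W1q_diagonalizable_curve[OF W(1,3)] assms(9) unfolding A'_def l'_def I by blast
  have curves: "AE x in lebesgue_on I. \<forall>n. diagonalizable_curve (An n) (lam_n n) (An' n x) (ln' n x) x"
    using W1q_diagonalizable_curve[OF W(2,4)] assms(10) unfolding AE_all_countable An'_def ln'_def I by blast
  have multiple: "AE x in lebesgue_on I. \<forall>i j. lam x $ i = lam x $ j \<longrightarrow> l' x $ i = l' x $ j"
    using W1q_multiple_components[OF W(3)] unfolding l'_def I .
  \<comment> \<open>The common majorant \<open>G + w n\<close> comes from bounding the eigenvalue
    derivatives by \<open>A'\<close> and \<open>An' n\<close>, with the latter split as
    \<open>A'\<close> plus an error.\<close>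
  define G where "G x = 2 powr q * norm (A' x) powr q" for x
  define w where "w n x = 2 powr q * norm (An' n x - A' x) powr q" for n x
  \<comment> \<open>\<open>u1\<close> serves the first claim. For the second, \<open>u2\<close>
    compares the integrals of the powers directly, without the triangle inequality in
    \<open>L^q\<close>.\<close>
  define u1 where "u1 n x = \<bar>norm (l' x) - norm (ln' n x)\<bar> powr q" for n x
  define u2 where "u2 n x = \<bar>norm (ln' n x) powr q - norm (l' x) powr q\<bar>" for n x
  have G: "integrable (lebesgue_on I) G"
    using Lq(1) by (simp add: G_def[abs_def] Lq_fun_def)
  have w: "integrable (lebesgue_on I) (w n)" for n
    using diff_int(2) by (simp add: w_def[abs_def])
  have w_lim: "(\<lambda>n. LINT x|lebesgue_on I. w n x) \<longlonglongrightarrow> 0"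
    using tendsto_mult_right_zero[OF lim1, of "2 powr q"] by (simp add: w_def)
  have bound: "AE x in lebesgue_on I. \<forall>n. u1 n x \<le> G x + w n x \<and> u2 n x \<le> G x + w n x"
    using curve curves
  proof eventually_elim
    case (elim x)
    show ?case
    proof
      fix n
      have l: "norm (l' x) \<le> norm (A' x)"
        using diagonalizable_curve.norm_derivative_le[OF elim(1)] .
      have "norm (ln' n x) \<le> norm (An' n x)"
        using diagonalizable_curve.norm_derivative_le elim(2) by blast
      also have "\<dots> \<le> norm (A' x) + norm (An' n x - A' x)"
        by (metis norm_triangle_sub)
      finally have ln: "norm (ln' n x) \<le> norm (A' x) + norm (An' n x - A' x)" .
      have "u1 n x \<le> (norm (A' x) + norm (An' n x - A' x)) powr q"
        unfolding u1_def using q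
        by (intro powr_mono2) (use l ln norm_ge_zero[of "ln' n x"] norm_ge_zero[of "l' x"]
          norm_ge_zero[of "An' n x - A' x"] in linarith)+
      moreover have "norm (ln' n x) powr q \<le> (norm (A' x) + norm (An' n x - A' x)) powr q"
        using q ln by (intro powr_mono2) auto
      moreover have "norm (l' x) powr q \<le> (norm (A' x) + norm (An' n x - A' x)) powr q"
        using q l by (intro powr_mono2) (auto intro: order_trans)
      ultimately show "u1 n x \<le> G x + w n x \<and> u2 n x \<le> G x + w n x"
        using powr_add_le[OF norm_ge_zero norm_ge_zero q(2), of "A' x" "An' n x - A' x"]
          powr_ge_zero[of "norm (ln' n x)" q] powr_ge_zero[of "norm (l' x)" q]
        unfolding u2_def G_def w_def by (intro conjI; linarith)
    qed
  qed
  have sub: "\<exists>s. strict_mono s \<and> (\<lambda>k. LINT x|lebesgue_on I. u1 (r (s k)) x) \<longlonglongrightarrow> 0 \<and>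
      (\<lambda>k. LINT x|lebesgue_on I. u2 (r (s k)) x) \<longlonglongrightarrow> 0" if r: "strict_mono r" for r :: "nat \<Rightarrow> nat"
  proof -
    \<comment> \<open>Adding both powers lets a single subsequence serve the matrices and their
      derivatives.\<close>
    define v where "v n x = norm (An n x - A x) powr q + norm (An' n x - A' x) powr q" for n x
    have "(\<lambda>n. LINT x|lebesgue_on I. norm (v n x)) \<longlonglongrightarrow> 0"
      using tendsto_add[OF lim0 lim1] diff_int by (simp add: v_def)
    then have "(\<lambda>k. LINT x|lebesgue_on I. norm (v (r k) x)) \<longlonglongrightarrow> 0"
      using LIMSEQ_subseq_LIMSEQ[OF _ r] by (force simp: o_def)
    moreover have "integrable (lebesgue_on I) (v (r k))" for k
      using diff_int by (simp add: v_def[abs_def])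
    ultimately obtain s where s: "strict_mono s" "AE x in lebesgue_on I. (\<lambda>k. v (r (s k)) x) \<longlonglongrightarrow> 0"
      using tendsto_L1_AE_subseq[of "lebesgue_on I" "\<lambda>k. v (r k)"] by blast
    have rs: "strict_mono (\<lambda>k. r (s k))"
      using r s(1) by (simp add: strict_mono_def)
    have lim: "AE x in lebesgue_on I. (\<lambda>k. u1 (r (s k)) x) \<longlonglongrightarrow> 0 \<and> (\<lambda>k. u2 (r (s k)) x) \<longlonglongrightarrow> 0"
      using s(2) curve curves multiple
    proof eventually_elim
      case (elim x)
      have vlim: "(\<lambda>k. X k) \<longlonglongrightarrow> X0"
        if "\<And>k. norm (X k - X0) powr q \<le> v (r (s k)) x" for X :: "nat \<Rightarrow> complex^'d^'d" and X0
      proof -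
        have "(\<lambda>k. norm (X k - X0) powr q) \<longlonglongrightarrow> 0"
          by (rule tendsto_sandwich[OF _ _ tendsto_const elim(1)]) (use that in auto)
        then have "(\<lambda>k. (norm (X k - X0) powr q) powr (1 / q)) \<longlonglongrightarrow> 0"
          by (rule tendsto_zero_powrI[OF _ tendsto_const]) (use q in auto)
        then have "(\<lambda>k. norm (X k - X0)) \<longlonglongrightarrow> 0"
          using q by (simp add: powr_powr)
        then show ?thesis by (simp add: tendsto_norm_zero_iff LIM_zero_iff)
      qed
      have A_lim: "(\<lambda>k. An (r (s k)) x) \<longlonglongrightarrow> A x" "(\<lambda>k. An' (r (s k)) x) \<longlonglongrightarrow> A' x"
        by (rule vlim; simp add: v_def)+
      have n_lim: "(\<lambda>k. norm (ln' (r (s k)) x)) \<longlonglongrightarrow> norm (l' x)"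
      proof (rule norm_eigenvalue_derivative_tendsto[where An = "\<lambda>k. An (r (s k))", OF elim(2) _ A_lim])
        show "diagonalizable_curve (An (r (s k))) (lam_n (r (s k))) (An' (r (s k)) x) (ln' (r (s k)) x) x" for k
          using elim(3) by blast
        show "l' x $ i = l' x $ j" if "lam x $ i = lam x $ j" for i j
          using elim(4) that by blast
      qed
      have "(\<lambda>k. \<bar>norm (l' x) - norm (ln' (r (s k)) x)\<bar>) \<longlonglongrightarrow> \<bar>norm (l' x) - norm (l' x)\<bar>"
        by (intro tendsto_rabs tendsto_diff tendsto_const n_lim)
      then have "(\<lambda>k. u1 (r (s k)) x) \<longlonglongrightarrow> 0"
        unfolding u1_def by (intro tendsto_zero_powrI[OF _ tendsto_const]) (use q in auto)
      moreover have "(\<lambda>k. norm (ln' (r (s k)) x) powr q) \<longlonglongrightarrow> norm (l' x) powr q"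
        using q by (intro tendsto_powr' n_lim tendsto_const) auto
      then have "(\<lambda>k. \<bar>norm (ln' (r (s k)) x) powr q - norm (l' x) powr q\<bar>)
          \<longlonglongrightarrow> \<bar>norm (l' x) powr q - norm (l' x) powr q\<bar>"
        by (intro tendsto_rabs tendsto_diff tendsto_const)
      then have "(\<lambda>k. u2 (r (s k)) x) \<longlonglongrightarrow> 0"
        unfolding u2_def by simp
      ultimately show ?case by blast
    qed
    have w_sub: "(\<lambda>k. LINT x|lebesgue_on I. w (r (s k)) x) \<longlonglongrightarrow> 0"
      using LIMSEQ_subseq_LIMSEQ[OF w_lim rs] by (simp add: o_def)
    have G0: "AE x in lebesgue_on I. 0 \<le> G x" and w0: "AE x in lebesgue_on I. 0 \<le> w n x" for n
      by (simp_all add: G_def w_def)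
    have "(\<lambda>k. LINT x|lebesgue_on I. u1 (r (s k)) x) \<longlonglongrightarrow> 0"
    proof (rule integral_tendsto_0_dominated[OF _ G w _ G0 w0 w_sub])
      show "AE x in lebesgue_on I. 0 \<le> u1 (r (s k)) x \<and> u1 (r (s k)) x \<le> G x + w (r (s k)) x" for k
        using bound by eventually_elim (simp add: u1_def)
      show "AE x in lebesgue_on I. (\<lambda>k. u1 (r (s k)) x) \<longlonglongrightarrow> 0"
        using lim by eventually_elim simp
    qed (simp add: u1_def[abs_def])
    moreover have "(\<lambda>k. LINT x|lebesgue_on I. u2 (r (s k)) x) \<longlonglongrightarrow> 0"
    proof (rule integral_tendsto_0_dominated[OF _ G w _ G0 w0 w_sub])
      show "AE x in lebesgue_on I. 0 \<le> u2 (r (s k)) x \<and> u2 (r (s k)) x \<le> G x + w (r (s k)) x" for k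
        using bound by eventually_elim (simp add: u2_def)
      show "AE x in lebesgue_on I. (\<lambda>k. u2 (r (s k)) x) \<longlonglongrightarrow> 0"
        using lim by eventually_elim simp
    qed (simp add: u2_def[abs_def])
    ultimately show ?thesis using s(1) by blast
  qed
  have u1_lim: "(\<lambda>n. LINT x|lebesgue_on I. u1 n x) \<longlonglongrightarrow> 0"
    by (rule LIMSEQ_subseq_subseq) (use sub in blast)
  have u2_lim: "(\<lambda>n. LINT x|lebesgue_on I. u2 n x) \<longlonglongrightarrow> 0"
    by (rule LIMSEQ_subseq_subseq) (use sub in blast)
  have int_l: "integrable (lebesgue_on I) (\<lambda>x. norm (l' x) powr q)"
    "integrable (lebesgue_on I) (\<lambda>x. norm (ln' n x) powr q)" for n
    using Lq(3,4) by (auto simp: Lq_fun_def)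
  have "(\<lambda>n. (LINT x|lebesgue_on I. norm (ln' n x) powr q) - (LINT x|lebesgue_on I. norm (l' x) powr q)) \<longlonglongrightarrow> 0"
  proof (rule Lim_null_comparison[OF _ u2_lim])
    have "norm ((LINT x|lebesgue_on I. norm (ln' n x) powr q) - (LINT x|lebesgue_on I. norm (l' x) powr q))
        \<le> (LINT x|lebesgue_on I. u2 n x)" for n
      using integral_norm_bound[of "lebesgue_on I" "\<lambda>x. norm (ln' n x) powr q - norm (l' x) powr q"] int_l
      by (simp add: u2_def)
    then show "\<forall>\<^sub>F n in sequentially. norm ((LINT x|lebesgue_on I. norm (ln' n x) powr q)
        - (LINT x|lebesgue_on I. norm (l' x) powr q)) \<le> (LINT x|lebesgue_on I. u2 n x)"
      by simp
  qed
  then have "(\<lambda>n. LINT x|lebesgue_on I. norm (ln' n x) powr q) \<longlonglongrightarrow> (LINT x|lebesgue_on I. norm (l' x) powr q)"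
    by (simp add: LIM_zero_iff)
  then have "(\<lambda>n. Lq_norm q I (ln' n)) \<longlonglongrightarrow> Lq_norm q I l'"
    unfolding Lq_norm_def using q by (intro tendsto_powr' tendsto_const) auto
  moreover have "(\<lambda>n. Lq_norm q I (\<lambda>x. norm (l' x) - norm (ln' n x))) \<longlonglongrightarrow> 0"
    unfolding Lq_norm_def using u1_lim q
    by (intro tendsto_zero_powrI[OF _ tendsto_const]) (auto simp: u1_def)
  ultimately show ?thesis
    by (simp add: l'_def ln'_def)
qed

end
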